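(* Let $D$ be a positive integer and $\theta\in(0,+\infty)^D$, put $|\theta|=\sum_{j=1}^D\theta_j$, and let $q(i,j)=\theta_j-|\theta|\mathbf 1_{i=j}$ for $1\le i,j\le D$. Let $(i_n)_{n\ge1}$ be a freezing Markov chain on $\{1,\dots,D\}$ with this $q$ and parameters $(p_n)$, $(r_n)$ as in the context, and assume that $p_n\sim a/n$ as $n\to+\infty$ for some $a>0$. Let $x_n=\frac1n\sum_{k=1}^n e_{i_k}$, where $(e_1,\dots,e_D)$ is the canonical basis of $\mathbb{R}^D$. Then the invariant probability vector $\nu$ of $q$ is given by $\nu_i=\theta_i|\theta|^{-1}$, and, in distribution, $$\lim_{n\to+\infty}(x_n,i_n)=\sum_{i=1}^D\nu_i\,\mathscr D(a\theta+e_i)\otimes\delta_i .$$ In particular, in distribution, $\lim_{n\to+\infty}x_n=\mathscr D(a\theta)$ and $\lim_{n\to+\infty}i_n=\nu^\top$ (i.e. $\mathbb{P}(i_n=i)\to\nu_i$ for every $i$).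
   Context: Freezing Markov chain: $(p_n)_{n\ge1}$ is a (weakly) decreasing sequence converging to some $p\in[0,1]$ with $\sum_{n\ge1}p_n=+\infty$. For $i\neq j$, $q_n(i,j)=p_n\,(q(i,j)+r_n(i,j))\ge0$ with $\lim_{n\to\infty} r_n(i,j)=0$, and $q_n(i,i)=-\sum_{j\neq i}q_n(i,j)$. $(i_n)_{n\ge1}$ is a time-inhomogeneous Markov chain on $\{1,\dots,D\}$, with arbitrary initial law, such that $\mathbb{P}(i_{n+1}=j\mid i_n=i)=q_n(i,j)$ for $i\neq j$ (so it stays at $i$ with probability $1+q_n(i,i)$). The invariant probability vector $\nu$ is the unique probability vector with $\nu^\top q=0$. $\mathscr D(\vartheta)$, $\vartheta\in(0,\infty)^D$, is the Dirichlet distribution on the simplex $\{x\in[0,1]^D:\sum_i x_i=1\}$, with density proportional to $\prod_k x_k^{\vartheta_k-1}$ with respect to Lebesgue measure on the simplex. *)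

theory Defs
  imports "HOL-Probability.Probability" "HOL-Library.Landau_Symbols"
begin

(* Off the diagonal, row i of the transition matrix at time n is q_n(i,j) = p_n (q(i,j) + r_n(i,j));
   the diagonal makes rows sum to 0, so the transition matrix is 1 + q_n and r_n(i,i) plays no role. *)
definition freezing_rate ::
  "(nat \<Rightarrow> real) \<Rightarrow> real^'d^'d \<Rightarrow> (nat \<Rightarrow> 'd \<Rightarrow> 'd \<Rightarrow> real) \<Rightarrow> nat \<Rightarrow> 'd::finite \<Rightarrow> 'd \<Rightarrow> real" where
  "freezing_rate p q r n i j =
     (if i = j then - (\<Sum>k\<in>UNIV - {i}. p n * (q $ i $ k + r n i k))
      else p n * (q $ i $ j + r n i j))"

(* All sequences are indexed by n \<ge> 1; their values at 0 are irrelevant. The conditional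
   probabilities are constrained only when the conditioning event has positive probability. *)
locale freezing_markov_chain = prob_space M
  for M :: "'a measure"
    and p :: "nat \<Rightarrow> real"
    and q :: "real^'d^'d"
    and r :: "nat \<Rightarrow> 'd \<Rightarrow> 'd \<Rightarrow> real"
    and I :: "nat \<Rightarrow> 'a \<Rightarrow> 'd::finite" +
  assumes p_antimono: "\<And>m n. 1 \<le> m \<Longrightarrow> m \<le> n \<Longrightarrow> p n \<le> p m"
    and p_convergent: "\<exists>l\<in>{0..1}. p \<longlonglongrightarrow> l"
    and p_sum: "filterlim (\<lambda>n. \<Sum>k=1..n. p k) at_top sequentially"
    and r_vanishes: "\<And>i j. i \<noteq> j \<Longrightarrow> (\<lambda>n. r n i j) \<longlonglongrightarrow> 0"
    and rate_nonneg: "\<And>n i j. 1 \<le> n \<Longrightarrow> i \<noteq> j \<Longrightarrow> 0 \<le> freezing_rate p q r n i j"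
    and measurable_state: "\<And>n. 1 \<le> n \<Longrightarrow> I n \<in> measurable M (count_space UNIV)"
    and markov_property:
      "\<And>n s j. 1 \<le> n \<Longrightarrow> \<P>(\<omega> in M. \<forall>k\<in>{1..n}. I k \<omega> = s k) > 0 \<Longrightarrow>
         \<P>(\<omega> in M. I (Suc n) \<omega> = j \<bar> \<forall>k\<in>{1..n}. I k \<omega> = s k) =
         \<P>(\<omega> in M. I (Suc n) \<omega> = j \<bar> I n \<omega> = s n)"
    and transition:
      "\<And>n i j. 1 \<le> n \<Longrightarrow> i \<noteq> j \<Longrightarrow> \<P>(\<omega> in M. I n \<omega> = i) > 0 \<Longrightarrow>
         \<P>(\<omega> in M. I (Suc n) \<omega> = j \<bar> I n \<omega> = i) = freezing_rate p q r n i j"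

definition empirical_measure :: "(nat \<Rightarrow> 'a \<Rightarrow> 'd) \<Rightarrow> nat \<Rightarrow> 'a \<Rightarrow> real^'d::finite" where
  "empirical_measure I n \<omega> = (1 / real n) *\<^sub>R (\<Sum>k=1..n. axis (I k \<omega>) 1)"

definition probability_vector :: "real^'d::finite \<Rightarrow> bool" where
  "probability_vector v \<longleftrightarrow> (\<forall>i. 0 \<le> v $ i) \<and> (\<Sum>i\<in>UNIV. v $ i) = 1"

definition invariant_probability_vector :: "real^'d^'d \<Rightarrow> real^'d::finite \<Rightarrow> bool" where
  "invariant_probability_vector q v \<longleftrightarrow> probability_vector v \<and> v v* q = 0"

definition prob_simplex :: "(real^'d::finite) set" where
  "prob_simplex = {x. (\<forall>i. x $ i \<in> {0..1}) \<and> (\<Sum>i\<in>UNIV. x $ i) = 1}"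

definition simplex_chart :: "'d \<Rightarrow> ('d \<Rightarrow> real) \<Rightarrow> real^'d::finite" where
  "simplex_chart k y = (\<chi> i. if i = k then 1 - (\<Sum>j\<in>UNIV - {k}. y j) else y i)"

(* Lebesgue measure on the hyperplane of vectors with coordinate sum 1, in the coordinates other
   than k; it is a point mass when there is only one coordinate. *)
definition hyperplane_lebesgue :: "'d \<Rightarrow> (real^'d::finite) measure" where
  "hyperplane_lebesgue k = distr (PiM (UNIV - {k}) (\<lambda>_. lborel)) borel (simplex_chart k)"

lemma simplex_chart_measurable [measurable]:
  "simplex_chart (k :: 'd::finite) \<in> measurable (PiM (UNIV - {k}) (\<lambda>_. lborel)) borel"
proof (rule borel_measurable_euclidean_space[THEN iffD2], rule ballI)
  fix b :: "real^'d" assume "b \<in> Basis"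
  then obtain i where b: "b = axis i 1" by (auto simp: Basis_vec_def)
  show "(\<lambda>y. simplex_chart k y \<bullet> b) \<in> borel_measurable (PiM (UNIV - {k}) (\<lambda>_. lborel))"
    by (cases "i = k") (auto simp: b inner_axis simplex_chart_def)
qed

lemma nn_integral_hyperplane_lebesgue:
  fixes k l :: "'d::finite"
  assumes kl: "k \<noteq> l" and f [measurable]: "f \<in> borel_measurable borel"
  shows "(\<integral>\<^sup>+x. f x \<partial>hyperplane_lebesgue k) =
    (\<integral>\<^sup>+y. (\<integral>\<^sup>+t. f (simplex_chart k (y(l := t))) \<partial>lborel) \<partial>PiM (UNIV - {k,l}) (\<lambda>_. lborel))"
proof -
  interpret product_sigma_finite "\<lambda>_::'d. lborel :: real measure" by standard
  have ins: "UNIV - {k} = insert l (UNIV - {k,l})" using kl by auto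
  show ?thesis
    unfolding hyperplane_lebesgue_def
    by (subst nn_integral_distr, simp, simp)
       (subst ins, subst product_nn_integral_insert, auto simp flip: ins)
qed

lemma hyperplane_lebesgue_independent:
  "hyperplane_lebesgue (k :: 'd::finite) = hyperplane_lebesgue l"
proof (cases "k = l")
  case False
  let ?J = "UNIV - {k,l}"
  have chart: "simplex_chart k (y(l := (1 - (\<Sum>j\<in>?J. y j)) - t)) = simplex_chart l (y(k := t))"
    for y :: "'d \<Rightarrow> real" and t
  proof -
    have "UNIV - {k} = insert l ?J" "UNIV - {l} = insert k ?J" using False by auto
    moreover have "(\<Sum>j\<in>?J. (y(l := u)) j) = (\<Sum>j\<in>?J. y j)"
      "(\<Sum>j\<in>?J. (y(k := u)) j) = (\<Sum>j\<in>?J. y j)" for u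
      by (auto intro!: sum.cong)
    ultimately show ?thesis
      using False by (auto simp: simplex_chart_def vec_eq_iff)
  qed
  show ?thesis
  proof (rule measure_eqI)
    show "sets (hyperplane_lebesgue k) = sets (hyperplane_lebesgue l)"
      by (simp add: hyperplane_lebesgue_def)
    fix A assume "A \<in> sets (hyperplane_lebesgue k)"
    then have A [measurable]: "A \<in> sets borel" by (simp add: hyperplane_lebesgue_def)
    let ?f = "indicator A :: real^'d \<Rightarrow> ennreal"
    have meas: "(\<lambda>t. ?f (simplex_chart k (y(l := t)))) \<in> borel_measurable borel" for y
    proof -
      have "(\<lambda>t. simplex_chart k (y(l := t))) \<in> borel_measurable borel"
      proof (rule borel_measurable_euclidean_space[THEN iffD2], rule ballI)
        fix b :: "real^'d" assume "b \<in> Basis"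
        then obtain i where b: "b = axis i 1" by (auto simp: Basis_vec_def)
        have upd: "(\<lambda>t. (y(l := t)) j) \<in> borel_measurable borel" for j
          by (cases "j = l") auto
        show "(\<lambda>t. simplex_chart k (y(l := t)) \<bullet> b) \<in> borel_measurable borel"
          by (cases "i = k")
             (simp_all add: b inner_axis simplex_chart_def upd borel_measurable_sum
                borel_measurable_diff del: fun_upd_apply)
      qed
      then show ?thesis by measurable
    qed
    have "emeasure (hyperplane_lebesgue k) A = (\<integral>\<^sup>+x. ?f x \<partial>hyperplane_lebesgue k)"
      by (simp add: hyperplane_lebesgue_def)
    also have "\<dots> = (\<integral>\<^sup>+y. (\<integral>\<^sup>+t. ?f (simplex_chart k (y(l := t))) \<partial>lborel) \<partial>PiM ?J (\<lambda>_. lborel))"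
      by (rule nn_integral_hyperplane_lebesgue) (use False in auto)
    also have "\<dots> = (\<integral>\<^sup>+y. (\<integral>\<^sup>+t. ?f (simplex_chart l (y(k := t))) \<partial>lborel) \<partial>PiM ?J (\<lambda>_. lborel))"
    proof (rule nn_integral_cong)
      fix y :: "'d \<Rightarrow> real"
      show "(\<integral>\<^sup>+t. ?f (simplex_chart k (y(l := t))) \<partial>lborel) =
            (\<integral>\<^sup>+t. ?f (simplex_chart l (y(k := t))) \<partial>lborel)"
        using nn_integral_real_affine[OF meas[of y], of "-1" "1 - (\<Sum>j\<in>?J. y j)"]
        by (simp add: chart)
    qed
    also have "\<dots> = (\<integral>\<^sup>+x. ?f x \<partial>hyperplane_lebesgue l)"
      using nn_integral_hyperplane_lebesgue[of l k ?f] False by (simp add: insert_commute)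
    also have "\<dots> = emeasure (hyperplane_lebesgue l) A"
      by (simp add: hyperplane_lebesgue_def)
    finally show "emeasure (hyperplane_lebesgue k) A = emeasure (hyperplane_lebesgue l) A" .
  qed
qed simp

(* The choice of the eliminated coordinate is immaterial by hyperplane_lebesgue_independent. *)
definition simplex_lebesgue :: "(real^'d::finite) measure" where
  "simplex_lebesgue = density (hyperplane_lebesgue (SOME k. True)) (indicator prob_simplex)"

definition dirichlet_weight :: "real^'d \<Rightarrow> real^'d::finite \<Rightarrow> real" where
  "dirichlet_weight \<theta> x = (\<Prod>k\<in>UNIV. x $ k powr (\<theta> $ k - 1))"

definition dirichlet :: "real^'d \<Rightarrow> (real^'d::finite) measure" where
  "dirichlet \<theta> = density simplex_lebesgue
     (\<lambda>x. ennreal (dirichlet_weight \<theta> x) / (\<integral>\<^sup>+y. ennreal (dirichlet_weight \<theta> y) \<partial>simplex_lebesgue))"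

definition finite_mixture :: "'b measure \<Rightarrow> real^'d \<Rightarrow> ('d::finite \<Rightarrow> 'b measure) \<Rightarrow> 'b measure" where
  "finite_mixture S w N =
     measure_of (space S) (sets S) (\<lambda>A. \<Sum>i\<in>UNIV. ennreal (w $ i) * emeasure (N i) A)"

lemma sets_finite_mixture [simp]: "sets (finite_mixture S w N) = sets S"
  by (simp add: finite_mixture_def)

lemma emeasure_finite_mixture:
  fixes S :: "'b measure"
  assumes N: "\<And>i. sets (N i) = sets S" and A: "A \<in> sets S"
  shows "emeasure (finite_mixture S w N) A = (\<Sum>i\<in>UNIV. ennreal (w $ i) * emeasure (N i) A)"
proof (rule emeasure_measure_of[OF finite_mixture_def])
  show "countably_additive (sets (finite_mixture S w N))
          (\<lambda>A. \<Sum>i\<in>UNIV. ennreal (w $ i) * emeasure (N i) A)"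
  proof (rule countably_additiveI)
    fix F :: "nat \<Rightarrow> 'b set"
    assume F: "range F \<subseteq> sets (finite_mixture S w N)" "disjoint_family F"
    have "(\<Sum>n. \<Sum>i\<in>UNIV. ennreal (w $ i) * emeasure (N i) (F n)) =
          (\<Sum>i\<in>UNIV. \<Sum>n. ennreal (w $ i) * emeasure (N i) (F n))"
      by (rule suminf_sum) auto
    also have "\<dots> = (\<Sum>i\<in>UNIV. ennreal (w $ i) * emeasure (N i) (\<Union> (range F)))"
      using F N by (auto intro!: sum.cong simp: ennreal_suminf_cmult suminf_emeasure)
    finally show "(\<Sum>n. \<Sum>i\<in>UNIV. ennreal (w $ i) * emeasure (N i) (F n)) =
          (\<Sum>i\<in>UNIV. ennreal (w $ i) * emeasure (N i) (\<Union> (range F)))" .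
  qed
qed (use A in \<open>auto simp: sets.space_closed positive_def dest: sets.sets_into_space\<close>)

(* The library's weak_conv_m only covers measures on the real line. This version is meant for
   measures whose sigma-algebra makes the bounded T-continuous functions measurable. *)
definition weakly_converges :: "'b topology \<Rightarrow> (nat \<Rightarrow> 'b measure) \<Rightarrow> 'b measure \<Rightarrow> bool" where
  "weakly_converges T \<mu> \<mu>' \<longleftrightarrow>
     (\<forall>f :: 'b \<Rightarrow> real. continuous_map T euclideanreal f \<and> bounded (f ` topspace T) \<longrightarrow>
        (\<lambda>n. \<integral>x. f x \<partial>\<mu> n) \<longlonglongrightarrow> (\<integral>x. f x \<partial>\<mu>'))"

end

theory Submission
  imports Defs
begin

text \<open>
  The proof is by the method of moments. All the mass sits on the compact simplex, where the
  polynomials are dense among the continuous functions, so it is enough to follow, for every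
  multi-index \<open>m\<close> and every state \<open>i\<close>, the quantity
  \<open>u\<^sub>n(m, i) = E[x\<^sub>n\<^sup>m; i\<^sub>n = i]\<close>; the lemma \<open>weighted_moment_method\<close> then turns convergence of these
  numbers into weak convergence of the pair, one state at a time.

  Two observations close the system of moments. First, \<open>x\<^sub>n\<close> is a function of the history, so the
  Markov property gives \<open>E[x\<^sub>n\<^sup>m; i\<^sub>n\<^sub>+\<^sub>1 = i]\<close> as the image of \<open>u\<^sub>n(m, \<cdot>)\<close> under \<open>1 + q\<^sub>n\<close>, and
  \<open>q\<^sub>n\<close> is \<open>(a/n) q + o(1/n)\<close>. Second, \<open>x\<^sub>n\<^sub>+\<^sub>1 = (n/(n+1)) (x\<^sub>n + e\<^sub>i / n)\<close> on \<open>i\<^sub>n\<^sub>+\<^sub>1 = i\<close>, so a first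
  order expansion of the monomial only produces \<open>m\<close> and \<open>m - e\<^sub>i\<close>. Since row \<open>i\<close> of \<open>q\<close> is
  \<open>\<theta> - |\<theta>| e\<^sub>i\<close>, the two effects add up to
  \<open>n (u\<^sub>n\<^sub>+\<^sub>1(m,i) - u\<^sub>n(m,i)) + (|m| + a|\<theta>|) u\<^sub>n(m,i)
       = m\<^sub>i u\<^sub>n(m - e\<^sub>i, i) + a \<theta>\<^sub>i U\<^sub>n(m) + o(1)\<close>,
  where \<open>U\<^sub>n(m)\<close> is the sum of \<open>u\<^sub>n(m, j)\<close> over the states \<open>j\<close>. Summing over \<open>i\<close> removes \<open>\<theta>\<close> and leaves
  \<open>n (U\<^sub>n\<^sub>+\<^sub>1(m) - U\<^sub>n(m)) + |m| U\<^sub>n(m) = \<Sum>\<^sub>i m\<^sub>i u\<^sub>n(m - e\<^sub>i, i) + o(1)\<close>.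
  A real sequence with \<open>n (v\<^sub>n\<^sub>+\<^sub>1 - v\<^sub>n) + c v\<^sub>n \<longlonglongrightarrow> b\<close> and \<open>c > 0\<close> converges to \<open>b/c\<close>
  (\<open>stochastic_approximation_limit\<close>), so induction on \<open>|m|\<close> yields every limit: first that of the
  total \<open>U\<^sub>n(m)\<close>, then that of each \<open>u\<^sub>n(m, i)\<close> (\<open>moment_limits\<close>).

  It remains to recognise the limits. The Dirichlet integral is computed by viewing
  \<open>t\<^sup>b\<^sup>-\<^sup>1 / \<Gamma>(b)\<close> on the half-line as a convolution semigroup in \<open>b\<close>
  (\<open>gamma_kernel_convolution_power\<close>); the resulting moments are ratios of rising factorials
  (\<open>dirichlet_moment\<close>), and these are the limits found by the induction.
\<close>

section \<open>Moments of the Dirichlet distribution\<close>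

text \<open>
  The density of the Gamma distribution of shape \<open>b\<close> without its exponential factor. That factor is
  multiplicative, so it does not disturb the convolution identity, and dropping it lets the kernel be
  evaluated at a fixed sum of the coordinates.
\<close>

definition gamma_kernel :: "real \<Rightarrow> real \<Rightarrow> real" where
  "gamma_kernel b t = (if 0 < t then t powr (b - 1) / Gamma b else 0)"

lemma gamma_kernel_nonneg: "0 < b \<Longrightarrow> 0 \<le> gamma_kernel b t"
  by (auto simp: gamma_kernel_def intro!: divide_nonneg_pos Gamma_real_pos)

lemma gamma_kernel_measurable [measurable]: "gamma_kernel b \<in> borel_measurable borel"
  unfolding gamma_kernel_def by measurable

text \<open>
  Scaling the integration variable by \<open>s\<close> pulls out the power of \<open>s\<close> and leaves Euler's Beta integral.
\<close>

lemma gamma_kernel_convolution: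
  assumes b: "0 < b" and c: "0 < c"
  shows "(\<integral>\<^sup>+t. ennreal (gamma_kernel b t) * ennreal (gamma_kernel c (s - t)) \<partial>lborel) =
    ennreal (gamma_kernel (b + c) s)"
proof (cases "0 < s")
  case False
  then have vanish: "ennreal (gamma_kernel b t) * ennreal (gamma_kernel c (s - t)) = 0" for t
    by (auto simp: gamma_kernel_def)
  show ?thesis unfolding vanish using False by (simp add: gamma_kernel_def)
next
  case True
  define K where "K = s powr (b + c - 2) / (Gamma b * Gamma c)"
  have Gpos: "0 < Gamma b" "0 < Gamma c" "0 < Gamma (b + c)"
    using b c by (auto intro!: Gamma_real_pos)
  have K: "0 \<le> K" using Gpos by (simp add: K_def)
  have beta: "(\<integral>\<^sup>+u. ennreal (u powr (b - 1) * (1 - u) powr (c - 1)) * indicator {0..1} u \<partial>lborel) =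
      ennreal (Beta b c)"
    by (rule nn_integral_has_integral_lebesgue'[OF _ has_integral_Beta_real[OF b c]]) auto
  have scaled: "ennreal (gamma_kernel b (0 + s * u)) * ennreal (gamma_kernel c (s - (0 + s * u))) =
      ennreal K * (ennreal (u powr (b - 1) * (1 - u) powr (c - 1)) * indicator {0..1} u)" for u
  proof (cases "0 < u \<and> u < 1")
    case u: True
    have 1: "s - s * u = s * (1 - u)" by (simp add: algebra_simps)
    have 2: "s powr (b - 1) * s powr (c - 1) = s powr (b + c - 2)"
      using True by (simp add: powr_add[symmetric])
    have "0 < s * u" "0 < s * (1 - u)" using u True by auto
    then have "gamma_kernel b (s * u) * gamma_kernel c (s - s * u) =
      (s powr (b - 1) * s powr (c - 1)) * (u powr (b - 1) * (1 - u) powr (c - 1)) / (Gamma b * Gamma c)"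
      using u True unfolding 1 gamma_kernel_def by (simp add: powr_mult)
    also have "\<dots> = K * (u powr (b - 1) * (1 - u) powr (c - 1))"
      unfolding 2 K_def by simp
    finally have "gamma_kernel b (s * u) * gamma_kernel c (s - s * u) =
      K * (u powr (b - 1) * (1 - u) powr (c - 1))" .
    then show ?thesis using u K gamma_kernel_nonneg b c
      by (simp add: ennreal_mult[symmetric])
  next
    case u: False
    consider "u \<le> 0" | "u \<ge> 1" using u by linarith
    then show ?thesis
    proof cases
      case 1
      then have "\<not> 0 < s * u" using True by (simp add: zero_less_mult_iff)
      with 1 show ?thesis by (auto simp: gamma_kernel_def indicator_def)
    next
      case 2
      then have "\<not> 0 < s - s * u" using True by simp
      with 2 show ?thesis by (auto simp: gamma_kernel_def indicator_def)
    qed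
  qed
  have "(\<integral>\<^sup>+t. ennreal (gamma_kernel b t) * ennreal (gamma_kernel c (s - t)) \<partial>lborel) =
      ennreal \<bar>s\<bar> * (\<integral>\<^sup>+u. ennreal (gamma_kernel b (0 + s * u)) *
        ennreal (gamma_kernel c (s - (0 + s * u))) \<partial>lborel)"
    using True by (intro nn_integral_real_affine) auto
  also have "\<dots> = ennreal s * (ennreal K * ennreal (Beta b c))"
    unfolding scaled using True by (subst nn_integral_cmult) (auto simp: beta)
  also have "\<dots> = ennreal (s * K * Beta b c)"
    using True K by (simp add: ennreal_mult' mult.assoc)
  also have "s * K * Beta b c = gamma_kernel (b + c) s"
  proof -
    have "s * s powr (b + c - 2) = s powr (b + c - 1)"
      using powr_mult_base[of s "b + c - 2"] True by simp
    then show ?thesis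
      using True Gpos by (simp add: K_def gamma_kernel_def Beta_def field_simps)
  qed
  finally show ?thesis .
qed

text \<open>
  Integrating out one coordinate at a time, each time merging its exponent with that of the remaining
  one. The case \<open>s = 1\<close> is the Dirichlet integral.
\<close>

lemma gamma_kernel_convolution_power:
  fixes b :: "'i \<Rightarrow> real"
  assumes "finite J" and "\<And>j. 0 < b j" and "0 < c"
  shows "(\<integral>\<^sup>+y. ennreal (\<Prod>j\<in>J. gamma_kernel (b j) (y j)) * ennreal (gamma_kernel c (s - (\<Sum>j\<in>J. y j)))
            \<partial>PiM J (\<lambda>_. lborel)) = ennreal (gamma_kernel ((\<Sum>j\<in>J. b j) + c) s)"
  using assms(1,3)
proof (induction J arbitrary: c rule: finite_induct)
  case empty
  show ?case by (simp add: PiM_empty nn_integral_count_space_finite)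
next
  case (insert l J)
  interpret product_sigma_finite "\<lambda>_::'i. lborel :: real measure" by standard
  have "(\<integral>\<^sup>+y. ennreal (\<Prod>j\<in>insert l J. gamma_kernel (b j) (y j)) *
        ennreal (gamma_kernel c (s - (\<Sum>j\<in>insert l J. y j))) \<partial>PiM (insert l J) (\<lambda>_. lborel)) =
     (\<integral>\<^sup>+y. (\<integral>\<^sup>+t. ennreal (\<Prod>j\<in>insert l J. gamma_kernel (b j) ((y(l := t)) j)) *
        ennreal (gamma_kernel c (s - (\<Sum>j\<in>insert l J. (y(l := t)) j))) \<partial>lborel) \<partial>PiM J (\<lambda>_. lborel))"
    using insert.hyps by (intro product_nn_integral_insert) auto
  also have "\<dots> = (\<integral>\<^sup>+y. ennreal (\<Prod>j\<in>J. gamma_kernel (b j) (y j)) *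
      ennreal (gamma_kernel (b l + c) (s - (\<Sum>j\<in>J. y j))) \<partial>PiM J (\<lambda>_. lborel))"
  proof (rule nn_integral_cong)
    fix y :: "'i \<Rightarrow> real"
    have upd: "(\<Prod>j\<in>J. gamma_kernel (b j) (if j = l then t else y j)) =
        (\<Prod>j\<in>J. gamma_kernel (b j) (y j))"
      "(\<Sum>j\<in>J. if j = l then t else y j) = (\<Sum>j\<in>J. y j)" for t
      using insert.hyps by (auto intro!: prod.cong sum.cong)
    have "(\<integral>\<^sup>+t. ennreal (\<Prod>j\<in>insert l J. gamma_kernel (b j) ((y(l := t)) j)) *
        ennreal (gamma_kernel c (s - (\<Sum>j\<in>insert l J. (y(l := t)) j))) \<partial>lborel) =
      (\<integral>\<^sup>+t. ennreal (\<Prod>j\<in>J. gamma_kernel (b j) (y j)) * (ennreal (gamma_kernel (b l) t) *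
        ennreal (gamma_kernel c ((s - (\<Sum>j\<in>J. y j)) - t))) \<partial>lborel)"
      using insert.hyps assms(2)
      by (intro nn_integral_cong) 
         (simp add: upd prod_nonneg gamma_kernel_nonneg ennreal_mult ac_simps algebra_simps)
    also have "\<dots> = ennreal (\<Prod>j\<in>J. gamma_kernel (b j) (y j)) *
      ennreal (gamma_kernel (b l + c) (s - (\<Sum>j\<in>J. y j)))"
      using assms(2) insert.prems
      by (subst nn_integral_cmult) (auto simp: gamma_kernel_convolution)
    finally show "(\<integral>\<^sup>+t. ennreal (\<Prod>j\<in>insert l J. gamma_kernel (b j) ((y(l := t)) j)) *
        ennreal (gamma_kernel c (s - (\<Sum>j\<in>insert l J. (y(l := t)) j))) \<partial>lborel) =
      ennreal (\<Prod>j\<in>J. gamma_kernel (b j) (y j)) *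
      ennreal (gamma_kernel (b l + c) (s - (\<Sum>j\<in>J. y j)))" .
  qed
  also have "\<dots> = ennreal (gamma_kernel ((\<Sum>j\<in>J. b j) + (b l + c)) s)"
    using assms(2)[of l] insert.prems by (intro insert.IH) simp
  also have "(\<Sum>j\<in>J. b j) + (b l + c) = (\<Sum>j\<in>insert l J. b j) + c"
    using insert.hyps by simp
  finally show ?case .
qed

definition dirichlet_normalizer :: "real^'d::finite \<Rightarrow> real" where
  "dirichlet_normalizer \<beta> = (\<Prod>k\<in>UNIV. Gamma (\<beta> $ k)) / Gamma (\<Sum>k\<in>UNIV. \<beta> $ k)"

lemma dirichlet_normalizer_pos:
  fixes \<beta> :: "real^'d::finite"
  assumes "\<And>k. 0 < \<beta> $ k"
  shows "0 < dirichlet_normalizer \<beta>"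
  unfolding dirichlet_normalizer_def using assms
  by (intro divide_pos_pos prod_pos Gamma_real_pos sum_pos) auto

lemma dirichlet_weight_measurable [measurable]: "dirichlet_weight \<beta> \<in> borel_measurable borel"
  unfolding dirichlet_weight_def by measurable

lemma closed_prob_simplex: "closed (prob_simplex :: (real^'d::finite) set)"
proof -
  have "prob_simplex = (\<Inter>i. {x::real^'d. 0 \<le> x $ i} \<inter> {x. x $ i \<le> 1}) \<inter> {x. (\<Sum>i\<in>UNIV. x $ i) = 1}"
    by (auto simp: prob_simplex_def)
  moreover have "closed \<dots>"
    by (intro closed_Int closed_INT ballI closed_Collect_le closed_Collect_eq continuous_intros)
  ultimately show ?thesis by simp
qed

lemma compact_prob_simplex: "compact (prob_simplex :: (real^'d::finite) set)"
proof -
  have "prob_simplex \<subseteq> cbox (0 :: real^'d) (\<chi> i. 1)"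
    by (auto simp: prob_simplex_def mem_box_cart)
  then show ?thesis using closed_prob_simplex bounded_subset[OF bounded_cbox]
    by (auto simp: compact_eq_bounded_closed)
qed

lemma prob_simplex_measurable [measurable]: "prob_simplex \<in> sets (borel :: (real^'d::finite) measure)"
  using closed_prob_simplex by (rule borel_closed)

lemma sets_simplex_lebesgue [simp, measurable_cong]: "sets simplex_lebesgue = sets borel"
  by (simp add: simplex_lebesgue_def hyperplane_lebesgue_def)

text \<open>
  The indicator of the simplex is absorbed by the kernels, which vanish on the negative half-line. At the
  boundary both sides are 0 because \<open>0 powr x = 0\<close>, even for \<open>x = 0\<close>.
\<close>

lemma dirichlet_weight_gamma_kernel:
  fixes \<beta> :: "real^'d::finite"
  assumes pos: "\<And>k. 0 < \<beta> $ k" and sum1: "(\<Sum>k\<in>UNIV. x $ k) = 1"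
  shows "dirichlet_weight \<beta> x * indicator prob_simplex x =
    (\<Prod>k\<in>UNIV. Gamma (\<beta> $ k)) * (\<Prod>k\<in>UNIV. gamma_kernel (\<beta> $ k) (x $ k))"
proof (cases "\<forall>k. 0 \<le> x $ k")
  case True
  have "x $ k \<le> 1" for k
    using member_le_sum[of k UNIV "\<lambda>k. x $ k"] True sum1 by simp
  then have "x \<in> prob_simplex" using True sum1 by (auto simp: prob_simplex_def)
  moreover have "x $ k powr (\<beta> $ k - 1) = Gamma (\<beta> $ k) * gamma_kernel (\<beta> $ k) (x $ k)" for k
    using True[rule_format, of k] Gamma_real_pos[OF pos[of k]] by (auto simp: gamma_kernel_def)
  ultimately show ?thesis by (simp add: dirichlet_weight_def prod.distrib)
next
  case False
  then obtain k where k: "x $ k < 0" by (auto simp: not_le)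
  then have "gamma_kernel (\<beta> $ k) (x $ k) = 0" by (simp add: gamma_kernel_def)
  then have "(\<Prod>k\<in>UNIV. gamma_kernel (\<beta> $ k) (x $ k)) = 0" by (intro prod_zero) auto
  moreover have "x \<notin> prob_simplex" using k by (auto simp: prob_simplex_def not_le)
  ultimately show ?thesis by simp
qed

lemma dirichlet_integral:
  fixes \<beta> :: "real^'d::finite"
  assumes pos: "\<And>k. 0 < \<beta> $ k"
  shows "(\<integral>\<^sup>+x. ennreal (dirichlet_weight \<beta> x) \<partial>simplex_lebesgue) = ennreal (dirichlet_normalizer \<beta>)"
proof -
  define l where "l = (SOME k::'d. True)"
  let ?G = "\<Prod>k\<in>UNIV. Gamma (\<beta> $ k)"
  have split: "(UNIV :: 'd set) = insert l (UNIV - {l})" by auto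
  have chart_sum: "(\<Sum>k\<in>UNIV. simplex_chart l y $ k) = 1" for y :: "'d \<Rightarrow> real"
    by (subst split, subst sum.insert) (auto simp: simplex_chart_def)
  have Gpos: "0 \<le> ?G" using pos by (intro prod_nonneg) (auto intro: less_imp_le Gamma_real_pos)
  have "(\<integral>\<^sup>+x. ennreal (dirichlet_weight \<beta> x) \<partial>simplex_lebesgue) =
      (\<integral>\<^sup>+x. ennreal (dirichlet_weight \<beta> x * indicator prob_simplex x) \<partial>hyperplane_lebesgue l)"
    unfolding simplex_lebesgue_def l_def[symmetric]
    by (subst nn_integral_density)
       (auto simp: hyperplane_lebesgue_def indicator_def intro!: nn_integral_cong)
  also have "\<dots> = (\<integral>\<^sup>+y. ennreal (dirichlet_weight \<beta> (simplex_chart l y) *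
      indicator prob_simplex (simplex_chart l y)) \<partial>PiM (UNIV - {l}) (\<lambda>_. lborel))"
    unfolding hyperplane_lebesgue_def by (subst nn_integral_distr) auto
  also have "\<dots> = (\<integral>\<^sup>+y. ennreal ?G * (ennreal (\<Prod>j\<in>UNIV - {l}. gamma_kernel (\<beta> $ j) (y j)) *
      ennreal (gamma_kernel (\<beta> $ l) (1 - (\<Sum>j\<in>UNIV - {l}. y j)))) \<partial>PiM (UNIV - {l}) (\<lambda>_. lborel))"
  proof (rule nn_integral_cong)
    fix y :: "'d \<Rightarrow> real"
    have "(\<Prod>k\<in>UNIV. gamma_kernel (\<beta> $ k) (simplex_chart l y $ k)) =
      gamma_kernel (\<beta> $ l) (1 - (\<Sum>j\<in>UNIV - {l}. y j)) * (\<Prod>j\<in>UNIV - {l}. gamma_kernel (\<beta> $ j) (y j))"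
      by (subst split, subst prod.insert) (auto simp: simplex_chart_def intro!: prod.cong)
    then show "ennreal (dirichlet_weight \<beta> (simplex_chart l y) *
      indicator prob_simplex (simplex_chart l y)) =
      ennreal ?G * (ennreal (\<Prod>j\<in>UNIV - {l}. gamma_kernel (\<beta> $ j) (y j)) *
      ennreal (gamma_kernel (\<beta> $ l) (1 - (\<Sum>j\<in>UNIV - {l}. y j))))"
      using Gpos pos
      by (simp add: dirichlet_weight_gamma_kernel[OF pos chart_sum] ennreal_mult' prod_nonneg
          gamma_kernel_nonneg mult.commute)
  qed
  also have "\<dots> = ennreal ?G * ennreal (gamma_kernel ((\<Sum>j\<in>UNIV - {l}. \<beta> $ j) + \<beta> $ l) 1)"
    using pos by (subst nn_integral_cmult) (auto simp: gamma_kernel_convolution_power)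
  also have "(\<Sum>j\<in>UNIV - {l}. \<beta> $ j) + \<beta> $ l = (\<Sum>j\<in>UNIV. \<beta> $ j)"
    by (subst (2) split, subst sum.insert) auto
  also have "ennreal ?G * ennreal (gamma_kernel \<dots> 1) = ennreal (dirichlet_normalizer \<beta>)"
    using Gpos by (simp add: gamma_kernel_def dirichlet_normalizer_def ennreal_mult'[symmetric])
  finally show ?thesis .
qed

lemma space_simplex_lebesgue [simp]: "space simplex_lebesgue = UNIV"
  using sets_eq_imp_space_eq[OF sets_simplex_lebesgue] by simp

lemma dirichlet_weight_nonneg: "0 \<le> dirichlet_weight \<beta> x"
  by (simp add: dirichlet_weight_def prod_nonneg)

lemma dirichlet_eq_density:
  fixes \<beta> :: "real^'d::finite"
  assumes pos: "\<And>k. 0 < \<beta> $ k"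
  shows "dirichlet \<beta> =
    density simplex_lebesgue (\<lambda>x. ennreal (dirichlet_weight \<beta> x / dirichlet_normalizer \<beta>))"
  using dirichlet_normalizer_pos[OF pos]
  by (simp add: dirichlet_def dirichlet_integral[OF pos] divide_ennreal dirichlet_weight_nonneg)

lemma sets_dirichlet [simp, measurable_cong]: "sets (dirichlet \<beta>) = sets borel"
  by (simp add: dirichlet_def)

lemma prob_space_dirichlet:
  fixes \<beta> :: "real^'d::finite"
  assumes pos: "\<And>k. 0 < \<beta> $ k"
  shows "prob_space (dirichlet \<beta>)"
proof
  note Z = dirichlet_normalizer_pos[OF pos]
  have "emeasure (dirichlet \<beta>) (space (dirichlet \<beta>)) =
      (\<integral>\<^sup>+x. ennreal (dirichlet_weight \<beta> x) / ennreal (dirichlet_normalizer \<beta>) \<partial>simplex_lebesgue)"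
    unfolding dirichlet_eq_density[OF pos]
    by (subst emeasure_density) (auto simp: divide_ennreal Z dirichlet_weight_nonneg intro!: nn_integral_cong)
  also have "\<dots> = ennreal (dirichlet_normalizer \<beta>) / ennreal (dirichlet_normalizer \<beta>)"
    by (subst nn_integral_divide) (auto simp: dirichlet_integral[OF pos])
  also have "\<dots> = 1" using Z by (simp add: divide_ennreal)
  finally show "emeasure (dirichlet \<beta>) (space (dirichlet \<beta>)) = 1" .
qed

lemma AE_simplex_lebesgue: "AE x in simplex_lebesgue. x \<in> prob_simplex"
  unfolding simplex_lebesgue_def
  by (subst AE_density) (auto simp: hyperplane_lebesgue_def indicator_def)

lemma AE_dirichlet:
  fixes \<beta> :: "real^'d::finite"
  assumes pos: "\<And>k. 0 < \<beta> $ k"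
  shows "AE x in dirichlet \<beta>. x \<in> prob_simplex"
  unfolding dirichlet_eq_density[OF pos]
  using AE_simplex_lebesgue by (subst AE_density) auto

lemma dirichlet_lebesgue_integral:
  fixes \<beta> :: "real^'d::finite"
  assumes pos: "\<And>k. 0 < \<beta> $ k" and f[measurable]: "f \<in> borel_measurable borel"
  shows "(\<integral>x. f x \<partial>dirichlet \<beta>) =
    (\<integral>x. dirichlet_weight \<beta> x * f x \<partial>simplex_lebesgue) / dirichlet_normalizer \<beta>"
proof -
  have "(\<integral>x. f x \<partial>dirichlet \<beta>) =
    (\<integral>x. (dirichlet_weight \<beta> x / dirichlet_normalizer \<beta>) *\<^sub>R f x \<partial>simplex_lebesgue)"
    unfolding dirichlet_eq_density[OF pos]
    using dirichlet_normalizer_pos[OF pos]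
    by (intro integral_density) (auto simp: dirichlet_weight_nonneg intro!: divide_nonneg_pos)
  also have "\<dots> = (\<integral>x. dirichlet_weight \<beta> x * f x / dirichlet_normalizer \<beta> \<partial>simplex_lebesgue)"
    by (intro Bochner_Integration.integral_cong) auto
  finally show ?thesis by simp
qed

definition monomial :: "('d \<Rightarrow> nat) \<Rightarrow> real^'d::finite \<Rightarrow> real" where
  "monomial m x = (\<Prod>k\<in>UNIV. (x $ k) ^ m k)"

lemma monomial_measurable [measurable]: "monomial m \<in> borel_measurable borel"
  unfolding monomial_def by measurable

lemma dirichlet_weight_monomial:
  fixes \<beta> :: "real^'d::finite"
  assumes "x \<in> prob_simplex"
  shows "dirichlet_weight \<beta> x * monomial m x = dirichlet_weight (\<beta> + (\<chi> k. real (m k))) x"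
proof -
  have "x $ k powr (\<beta> $ k - 1) * x $ k ^ m k = x $ k powr (\<beta> $ k + real (m k) - 1)" for k
  proof (cases "x $ k = 0")
    case False
    then have "0 < x $ k" using assms by (auto simp: prob_simplex_def less_le)
    then show ?thesis by (simp add: powr_realpow[symmetric] powr_add[symmetric] algebra_simps)
  qed auto
  then show ?thesis by (simp add: dirichlet_weight_def monomial_def prod.distrib[symmetric])
qed

text \<open>
  Multiplying the weight by a monomial only shifts its parameters, so a moment is a quotient of two
  normalizing constants, and \<open>\<Gamma>(x + n) / \<Gamma>(x)\<close> is a rising factorial.
\<close>

lemma dirichlet_moment:
  fixes \<beta> :: "real^'d::finite"
  assumes pos: "\<And>k. 0 < \<beta> $ k"
  shows "(\<integral>x. monomial m x \<partial>dirichlet \<beta>) =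
    (\<Prod>k\<in>UNIV. pochhammer (\<beta> $ k) (m k)) / pochhammer (\<Sum>k\<in>UNIV. \<beta> $ k) (\<Sum>k\<in>UNIV. m k)"
proof -
  let ?\<beta> = "\<beta> + (\<chi> k. real (m k))"
  have pos': "0 < ?\<beta> $ k" for k using pos[of k] by simp
  have S: "0 < (\<Sum>k\<in>UNIV. \<beta> $ k)" using pos by (intro sum_pos) auto
  have "(\<integral>x. dirichlet_weight \<beta> x * monomial m x \<partial>simplex_lebesgue) =
      (\<integral>x. dirichlet_weight ?\<beta> x \<partial>simplex_lebesgue)"
    by (rule integral_cong_AE, simp, simp, rule AE_mp[OF AE_simplex_lebesgue])
       (auto simp: dirichlet_weight_monomial)
  also have "\<dots> = dirichlet_normalizer ?\<beta>"
    by (subst integral_eq_nn_integral)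
       (auto simp: dirichlet_weight_nonneg dirichlet_integral[OF pos'] less_imp_le[OF dirichlet_normalizer_pos[OF pos']])
  finally have "(\<integral>x. monomial m x \<partial>dirichlet \<beta>) = dirichlet_normalizer ?\<beta> / dirichlet_normalizer \<beta>"
    by (subst dirichlet_lebesgue_integral[OF pos]) auto
  moreover have "Gamma (\<beta> $ k + real (m k)) = pochhammer (\<beta> $ k) (m k) * Gamma (\<beta> $ k)" for k
    using pos[of k] less_imp_neq[OF Gamma_real_pos[OF pos[of k]]]
    by (subst pochhammer_Gamma) (auto dest: nonpos_Ints_nonpos)
  moreover have "Gamma ((\<Sum>k\<in>UNIV. \<beta> $ k) + real (\<Sum>k\<in>UNIV. m k)) =
      pochhammer (\<Sum>k\<in>UNIV. \<beta> $ k) (\<Sum>k\<in>UNIV. m k) * Gamma (\<Sum>k\<in>UNIV. \<beta> $ k)"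
    using S less_imp_neq[OF Gamma_real_pos[OF S]] by (subst pochhammer_Gamma) (auto dest: nonpos_Ints_nonpos)
  moreover have "(\<Prod>k\<in>UNIV. Gamma (\<beta> $ k)) \<noteq> 0" "Gamma (\<Sum>k\<in>UNIV. \<beta> $ k) \<noteq> 0"
    using Gamma_real_pos[OF pos] Gamma_real_pos[OF S] by (auto simp: less_le prod_zero_iff)
  ultimately show ?thesis
    by (simp add: dirichlet_normalizer_def sum.distrib prod.distrib)
qed

section \<open>From moments to weak convergence\<close>

text \<open>
  The linear span of the monomials. As an inductive predicate it lets linear statements about
  monomials be transferred by rule induction.
\<close>

inductive monomial_combination :: "(real^'d::finite \<Rightarrow> real) \<Rightarrow> bool" where
  monomial: "monomial_combination (monomial m)"
| scale: "monomial_combination f \<Longrightarrow> monomial_combination (\<lambda>x. c * f x)"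
| add: "monomial_combination f \<Longrightarrow> monomial_combination g \<Longrightarrow> monomial_combination (\<lambda>x. f x + g x)"

lemma monomial_combination_sum:
  assumes "finite A" "\<And>i. i \<in> A \<Longrightarrow> monomial_combination (f i)"
  shows "monomial_combination (\<lambda>x. \<Sum>i\<in>A. f i x)"
  using assms
proof (induction A rule: finite_induct)
  case empty
  show ?case using scale[OF monomial, of 0] by simp
qed (auto intro: monomial_combination.add)

lemma monomial_combination_times_coordinate:
  assumes "monomial_combination f"
  shows "monomial_combination (\<lambda>x. x $ k * f x)"
  using assms
proof induction
  case (monomial m)
  have "x $ k * monomial m x = monomial (m(k := Suc (m k))) x" for x :: "real^'a"
  proof -
    have U: "(UNIV :: 'a set) = insert k (UNIV - {k})" by auto
    show ?thesis unfolding monomial_def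
      by (subst (1 2) U, subst (1 2) prod.insert) (auto intro!: prod.cong)
  qed
  then have "(\<lambda>x. x $ k * monomial m x) = monomial (m(k := Suc (m k)))" by auto
  then show ?case by (simp add: monomial_combination.monomial)
next
  case (scale f c)
  then show ?case using monomial_combination.scale[OF scale.IH, of c] by (simp add: ac_simps)
next
  case (add f g)
  then show ?case using monomial_combination.add[OF add.IH] by (simp add: algebra_simps)
qed

text \<open>
  Closure of the span under products of two polynomials would need a double induction; multiplying by
  an arbitrary member \<open>g\<close> of the span makes the product case immediate, and \<open>g = 1\<close> recovers \<open>f\<close>.
\<close>

lemma monomial_combination_times_polynomial:
  fixes f :: "real^'d::finite \<Rightarrow> real"
  assumes "real_polynomial_function f" "monomial_combination g"
  shows "monomial_combination (\<lambda>x. f x * g x)"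
  using assms
proof (induction arbitrary: g)
  case (linear f)
  note g = \<open>monomial_combination g\<close>
  interpret bounded_linear f by fact
  have "f x = (\<Sum>k\<in>UNIV. f (axis k 1) * x $ k)" for x
  proof -
    have "x = (\<Sum>k\<in>UNIV. x $ k *\<^sub>R axis k 1)"
      using basis_expansion[of x] by (simp only: scalar_mult_eq_scaleR)
    then have "f x = f (\<Sum>k\<in>UNIV. x $ k *\<^sub>R axis k 1)" by (rule arg_cong)
    also have "\<dots> = (\<Sum>k\<in>UNIV. f (axis k 1) * x $ k)"
      by (simp only: sum scaleR real_scaleR_def mult.commute)
    finally show ?thesis .
  qed
  then have "f x * g x = (\<Sum>k\<in>UNIV. f (axis k 1) * x $ k) * g x" for x
    by (rule arg_cong)
  then have "f x * g x = (\<Sum>k\<in>UNIV. f (axis k 1) * (x $ k * g x))" for x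
    unfolding sum_distrib_right mult.assoc .
  moreover have "monomial_combination (\<lambda>x. \<Sum>k\<in>UNIV. f (axis k 1) * (x $ k * g x))"
    using g by (intro monomial_combination_sum monomial_combination.scale
        monomial_combination_times_coordinate) auto
  ultimately show ?case by presburger
next
  case (const c)
  then show ?case by (intro monomial_combination.scale)
next
  case (add f1 f2)
  then show ?case by (simp add: distrib_right monomial_combination.add)
next
  case (mult f1 f2)
  then show ?case by (simp add: mult.assoc)
qed

lemma monomial_combination_of_polynomial:
  fixes f :: "real^'d::finite \<Rightarrow> real"
  assumes "real_polynomial_function f"
  shows "monomial_combination f"
proof -
  have "monomial (\<lambda>_. 0) = (\<lambda>x :: real^'d. 1)" by (auto simp: monomial_def)
  moreover have "monomial_combination (monomial (\<lambda>_. 0) :: real^'d \<Rightarrow> real)"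
    by (rule monomial_combination.monomial)
  ultimately have "monomial_combination (\<lambda>x :: real^'d. 1)" by simp
  from monomial_combination_times_polynomial[OF assms this] show ?thesis by simp
qed

lemma monomial_combination_continuous:
  assumes "monomial_combination f"
  shows "continuous_on UNIV f"
  using assms
proof induction
  case (monomial m)
  show ?case unfolding monomial_def by (intro continuous_intros)
qed (auto intro!: continuous_intros)

text \<open>
  By Stone--Weierstrass a continuous function is uniformly close on the simplex to a combination of
  monomials, and the weights are bounded, so replacing the function by the polynomial costs little on
  both sides. The weights \<open>W\<close> and the constant \<open>c\<close> make the lemma applicable to a sub-probability such as
  the restriction to one state, without conditioning.
\<close>

lemma weighted_moment_method:
  fixes X :: "nat \<Rightarrow> 'a \<Rightarrow> real^'d::finite" and W :: "nat \<Rightarrow> 'a \<Rightarrow> real"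
    and f :: "real^'d \<Rightarrow> real"
  assumes M: "prob_space M" and X [measurable]: "\<And>n. X n \<in> borel_measurable M"
    and W [measurable]: "\<And>n. W n \<in> borel_measurable M"
    and W01: "\<And>n \<omega>. W n \<omega> \<in> {0..1}" and Xs: "\<And>n \<omega>. X n \<omega> \<in> prob_simplex"
    and N: "prob_space N" "sets N = sets borel" and Ns: "AE x in N. x \<in> prob_simplex"
    and moments: "\<And>m. (\<lambda>n. \<integral>\<omega>. W n \<omega> * monomial m (X n \<omega>) \<partial>M) \<longlonglongrightarrow>
                    c * (\<integral>x. monomial m x \<partial>N)"
    and f: "continuous_on UNIV f"
  shows "(\<lambda>n. \<integral>\<omega>. W n \<omega> * f (X n \<omega>) \<partial>M) \<longlonglongrightarrow> c * (\<integral>x. f x \<partial>N)"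
proof -
  interpret M: prob_space M by fact
  interpret N: prob_space N by fact
  have meas [measurable]: "g \<in> borel_measurable borel"
    if "continuous_on UNIV g" for g :: "real^'d \<Rightarrow> real"
    using that by (rule borel_measurable_continuous_onI)
  have bound: "\<exists>B. \<forall>x\<in>prob_simplex. \<bar>g x\<bar> \<le> B"
    if "continuous_on UNIV g" for g :: "real^'d \<Rightarrow> real"
  proof -
    have "compact (g ` prob_simplex)"
      using continuous_on_subset[OF that] compact_prob_simplex by (intro compact_continuous_image) auto
    then show ?thesis by (auto dest!: compact_imp_bounded simp: bounded_iff)
  qed
  have WB: "\<bar>W n \<omega> * y\<bar> \<le> B" if "\<bar>y\<bar> \<le> B" for n \<omega> y B
    using W01[of n \<omega>] that mult_mono[of "W n \<omega>" 1 "\<bar>y\<bar>" B] by (auto simp: abs_mult)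
  have intM: "integrable M (\<lambda>\<omega>. W n \<omega> * g (X n \<omega>))"
    if g: "continuous_on UNIV g" for n and g :: "real^'d \<Rightarrow> real"
  proof -
    obtain B where "\<forall>x\<in>prob_simplex. \<bar>g x\<bar> \<le> B" using bound[OF g] by auto
    then show ?thesis using meas[OF g] Xs WB
      by (intro M.integrable_const_bound[where B = B]) auto
  qed
  have intN: "integrable N g" if g: "continuous_on UNIV g" for g :: "real^'d \<Rightarrow> real"
  proof -
    obtain B where "\<forall>x\<in>prob_simplex. \<bar>g x\<bar> \<le> B" using bound[OF g] by auto
    then show ?thesis using meas[OF g] AE_mp[OF Ns] N(2)
      by (intro N.integrable_const_bound[where B = B]) (auto cong: measurable_cong_sets)
  qed
  have poly: "(\<lambda>n. \<integral>\<omega>. W n \<omega> * g (X n \<omega>) \<partial>M) \<longlonglongrightarrow> c * (\<integral>x. g x \<partial>N)"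
    if "monomial_combination g" for g
    using that
  proof induction
    case (monomial m)
    show ?case by (rule moments)
  next
    case (scale g b)
    have "(\<lambda>n. b * (\<integral>\<omega>. W n \<omega> * g (X n \<omega>) \<partial>M)) \<longlonglongrightarrow> b * (c * (\<integral>x. g x \<partial>N))"
      by (intro tendsto_mult_left scale.IH)
    then show ?case by (simp add: mult.left_commute[of _ b])
  next
    case (add g h)
    note gh = add.hyps[THEN monomial_combination_continuous]
    show ?case
      using tendsto_add[OF add.IH] intM[OF gh(1)] intM[OF gh(2)] intN[OF gh(1)] intN[OF gh(2)]
      by (simp add: distrib_left)
  qed
  show ?thesis
  proof (rule LIMSEQ_I)
    fix e :: real assume "0 < e"
    \<comment> \<open>\<open>d\<close> for exchanging the function under \<open>M\<close>, \<open>d\<close> for the convergence of the polynomial, \<open>\<bar>c\<bar> d\<close> for exchanging the function in the limit\<close>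
    define d where "d = e / (2 + \<bar>c\<bar>)"
    have "0 < 2 + \<bar>c\<bar>" by simp
    then have "0 < d" "d * (2 + \<bar>c\<bar>) = e"
      using \<open>0 < e\<close> unfolding d_def by (auto simp del: abs_not_less_zero)
    then have d: "0 < d" "2 * d + \<bar>c\<bar> * d = e" by (simp_all add: algebra_simps)
    obtain g where "real_polynomial_function g" and fg: "\<And>x. x \<in> prob_simplex \<Longrightarrow> \<bar>f x - g x\<bar> < d"
      using Stone_Weierstrass_real_polynomial_function[OF compact_prob_simplex
          continuous_on_subset[OF f subset_UNIV] d(1)] by metis
    then have "monomial_combination g" by (intro monomial_combination_of_polynomial)
    note g = monomial_combination_continuous[OF this] and lim = poly[OF this]
    have 1: "\<bar>(\<integral>\<omega>. W n \<omega> * f (X n \<omega>) \<partial>M) - (\<integral>\<omega>. W n \<omega> * g (X n \<omega>) \<partial>M)\<bar> \<le> d" for n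
    proof -
      have "\<bar>W n \<omega> * f (X n \<omega>) - W n \<omega> * g (X n \<omega>)\<bar> \<le> d" for \<omega>
        using WB[of "f (X n \<omega>) - g (X n \<omega>)" d n \<omega>] fg[OF Xs[of n \<omega>]] by (simp add: algebra_simps)
      then have "(\<integral>\<omega>. \<bar>W n \<omega> * f (X n \<omega>) - W n \<omega> * g (X n \<omega>)\<bar> \<partial>M) \<le> (\<integral>\<omega>. d \<partial>M)"
        by (intro integral_mono integrable_abs Bochner_Integration.integrable_diff intM f g) auto
      from order_trans[OF integral_abs_bound this] show ?thesis
        by (simp add: Bochner_Integration.integral_diff[OF intM[OF f] intM[OF g]] M.prob_space)
    qed
    have 2: "\<bar>(\<integral>x. g x \<partial>N) - (\<integral>x. f x \<partial>N)\<bar> \<le> d"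
    proof -
      have close: "AE x in N. \<bar>g x - f x\<bar> \<le> d"
        using Ns by eventually_elim (use fg in \<open>force simp: abs_minus_commute\<close>)
      have "\<bar>\<integral>x. g x - f x \<partial>N\<bar> \<le> (\<integral>x. \<bar>g x - f x\<bar> \<partial>N)" by (rule integral_abs_bound)
      also have "\<dots> \<le> (\<integral>x. d \<partial>N)"
        by (intro integral_mono_AE integrable_abs Bochner_Integration.integrable_diff intN f g close) simp
      finally show ?thesis
        by (simp add: Bochner_Integration.integral_diff[OF intN[OF g] intN[OF f]] N.prob_space)
    qed
    have 3: "\<bar>c * (\<integral>x. g x \<partial>N) - c * (\<integral>x. f x \<partial>N)\<bar> \<le> \<bar>c\<bar> * d"
      using mult_left_mono[OF 2, of "\<bar>c\<bar>"] by (simp add: abs_mult[symmetric] right_diff_distrib)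
    obtain K where K: "\<And>n. n \<ge> K \<Longrightarrow> \<bar>(\<integral>\<omega>. W n \<omega> * g (X n \<omega>) \<partial>M) - c * (\<integral>x. g x \<partial>N)\<bar> < d"
      using LIMSEQ_D[OF lim d(1)] by (auto simp: real_norm_def)
    show "\<exists>K. \<forall>n\<ge>K. norm ((\<integral>\<omega>. W n \<omega> * f (X n \<omega>) \<partial>M) - c * (\<integral>x. f x \<partial>N)) < e"
    proof (intro exI allI impI)
      fix n assume "K \<le> n"
      from K[OF this] 1[of n] 3 d(2)
      show "norm ((\<integral>\<omega>. W n \<omega> * f (X n \<omega>) \<partial>M) - c * (\<integral>x. f x \<partial>N)) < e"
        unfolding real_norm_def by linarith
    qed
  qed
qed

lemma nn_integral_finite_mixture:
  fixes w :: "real^'d::finite" and f :: "'b \<Rightarrow> ennreal"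
  assumes N: "\<And>i. sets (N i) = sets S" and f: "f \<in> borel_measurable S"
  shows "(\<integral>\<^sup>+x. f x \<partial>finite_mixture S w N) = (\<Sum>i\<in>UNIV. ennreal (w $ i) * (\<integral>\<^sup>+x. f x \<partial>N i))"
  using f
proof (induction rule: borel_measurable_induct)
  note [measurable_cong] = N
  note sp = sets_eq_imp_space_eq[OF N] sets_eq_imp_space_eq[OF sets_finite_mixture]
  {
    case (cong f g)
    moreover have "(\<integral>\<^sup>+x. f x \<partial>finite_mixture S w N) = (\<integral>\<^sup>+x. g x \<partial>finite_mixture S w N)"
      "\<And>i. (\<integral>\<^sup>+x. f x \<partial>N i) = (\<integral>\<^sup>+x. g x \<partial>N i)"
      using cong(3) by (auto intro!: nn_integral_cong simp: sp)
    ultimately show ?case by simp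
  next
    case (set A)
    then show ?case by (simp add: N emeasure_finite_mixture)
  next
    case (mult u c)
    then show ?case
      by (simp add: nn_integral_cmult sum_distrib_left mult.left_commute N cong: measurable_cong_sets)
  next
    case (add u v)
    then show ?case
      by (simp add: nn_integral_add sum.distrib distrib_left N cong: measurable_cong_sets)
  next
    case (seq U)
    have "(\<integral>\<^sup>+x. (SUP k. U k x) \<partial>finite_mixture S w N) =
        (SUP k. \<Sum>i\<in>UNIV. ennreal (w $ i) * (\<integral>\<^sup>+x. U k x \<partial>N i))"
      using seq by (subst nn_integral_monotone_convergence_SUP) (auto cong: measurable_cong_sets)
    also have "\<dots> = (\<Sum>i\<in>UNIV. SUP k. ennreal (w $ i) * (\<integral>\<^sup>+x. U k x \<partial>N i))"
      using \<open>incseq U\<close> by (intro ennreal_SUP_sum)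
        (auto simp: incseq_def le_fun_def intro!: mult_left_mono nn_integral_mono)
    also have "\<dots> = (\<Sum>i\<in>UNIV. ennreal (w $ i) * (\<integral>\<^sup>+x. (SUP k. U k x) \<partial>N i))"
      using seq N by (subst nn_integral_monotone_convergence_SUP)
        (auto simp: SUP_mult_left_ennreal cong: measurable_cong_sets)
    finally show ?case by (simp add: image_comp)
  }
qed

lemma integral_finite_mixture:
  fixes w :: "real^'d::finite" and f :: "'b \<Rightarrow> real"
  assumes N: "\<And>i. sets (N i) = sets S" "\<And>i. prob_space (N i)" and w: "\<And>i. 0 \<le> w $ i"
    and f [measurable]: "f \<in> borel_measurable S" and B: "\<And>x. \<bar>f x\<bar> \<le> B"
  shows "(\<integral>x. f x \<partial>finite_mixture S w N) = (\<Sum>i\<in>UNIV. w $ i * (\<integral>x. f x \<partial>N i))"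
proof -
  interpret N: prob_space "N i" for i by (rule N)
  note sp = sets_eq_imp_space_eq[OF N(1)] sets_eq_imp_space_eq[OF sets_finite_mixture]
  have "emeasure (finite_mixture S w N) (space (finite_mixture S w N)) = (\<Sum>i\<in>UNIV. ennreal (w $ i))"
    using N.emeasure_space_1 by (simp add: sp emeasure_finite_mixture N)
  then have fin: "finite_measure (finite_mixture S w N)"
    by (intro finite_measureI) (auto simp: sum_ennreal[OF w])
  have intm: "integrable (finite_mixture S w N) f"
    using B f by (intro finite_measure.integrable_const_bound[OF fin, where B = B]) 
      (auto cong: measurable_cong_sets)
  have int: "integrable (N i) f" for i
    using B f N by (intro N.integrable_const_bound[where B = B]) (auto cong: measurable_cong_sets)
  have top: "(\<integral>\<^sup>+x. ennreal (f x) \<partial>N i) < top" "(\<integral>\<^sup>+x. ennreal (- f x) \<partial>N i) < top" for i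
    using int[of i] by (auto simp: real_integrable_def top.not_eq_extremum)
  have "enn2real (\<integral>\<^sup>+x. ennreal (g x) \<partial>finite_mixture S w N) =
      (\<Sum>i\<in>UNIV. w $ i * enn2real (\<integral>\<^sup>+x. ennreal (g x) \<partial>N i))"
    if "\<And>i. (\<integral>\<^sup>+x. ennreal (g x) \<partial>N i) < top" "g \<in> borel_measurable S" for g
    using that w
    by (subst nn_integral_finite_mixture[OF N(1)])
       (auto simp: enn2real_sum ennreal_mult_less_top enn2real_mult)
  note this[OF top(1) f] this[OF top(2)]
  then show ?thesis
    by (simp add: real_lebesgue_integral_def[OF intm] real_lebesgue_integral_def[OF int]
        sum_subtractf right_diff_distrib)
qed

text \<open>
  The second factor is a point mass, so the product is the image of \<open>N\<close> under \<open>x \<mapsto> (x, i)\<close>.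
\<close>

lemma integral_pair_return:
  fixes N :: "(real^'d::finite) measure" and f :: "(real^'d) \<times> 'e::finite \<Rightarrow> real"
  assumes N: "prob_space N" "sets N = sets borel"
    and f [measurable]: "f \<in> borel_measurable (borel \<Otimes>\<^sub>M count_space UNIV)"
  shows "(\<integral>z. f z \<partial>(N \<Otimes>\<^sub>M return (count_space UNIV) i)) = (\<integral>x. f (x, i) \<partial>N)"
proof -
  interpret N: prob_space N by fact
  interpret R: prob_space "return (count_space UNIV) i" by (rule prob_space_return) simp
  note [measurable_cong] = N(2)
  have "N \<Otimes>\<^sub>M return (count_space UNIV) i = distr N (borel \<Otimes>\<^sub>M count_space UNIV) (\<lambda>x. (x, i))"
  proof (rule pair_measure_eqI)
    show "sets (N \<Otimes>\<^sub>M return (count_space UNIV) i) =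
        sets (distr N (borel \<Otimes>\<^sub>M count_space UNIV) (\<lambda>x. (x, i)))"
      unfolding sets_distr by (intro sets_pair_measure_cong N(2)) simp
    fix A :: "(real^'d) set" and C :: "'e set"
    assume A: "A \<in> sets N" and "C \<in> sets (return (count_space UNIV) i)"
    have "space N = UNIV" using sets_eq_imp_space_eq[OF N(2)] by simp
    then have "(\<lambda>x. (x, i)) -` (A \<times> C) \<inter> space N = (if i \<in> C then A else {})" by auto
    moreover have "A \<times> C \<in> sets (borel \<Otimes>\<^sub>M count_space UNIV)" using A N(2) by auto
    ultimately show "emeasure N A * emeasure (return (count_space UNIV) i) C =
        emeasure (distr N (borel \<Otimes>\<^sub>M count_space UNIV) (\<lambda>x. (x, i))) (A \<times> C)"
      by (subst emeasure_distr) (auto simp: indicator_def)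
  qed (unfold_locales)
  then show ?thesis by (simp add: integral_distr)
qed

section \<open>Recursions with decreasing steps\<close>

text \<open>
  The deviation from \<open>b / c\<close> is multiplied by \<open>1 - c/n\<close> and perturbed by \<open>o(1)/n\<close>. Beyond a fixed
  \<open>\<epsilon>\<close> the contraction absorbs the perturbation, so the excess \<open>z\<close> over \<open>\<epsilon>\<close> contracts by
  \<open>1 - c/n \<le> (n/(n+1))\<^sup>c\<close>. Hence \<open>z\<^sub>n n\<^sup>c\<close> is eventually nonincreasing and \<open>z\<^sub>n\<close> is \<open>O(n\<^sup>-\<^sup>c)\<close>.
\<close>

lemma stochastic_approximation_limit:
  fixes v :: "nat \<Rightarrow> real"
  assumes c: "0 < c" and drift: "(\<lambda>n. real n * (v (Suc n) - v n) + c * v n) \<longlonglongrightarrow> b"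
  shows "v \<longlonglongrightarrow> b / c"
proof (rule LIMSEQ_I)
  fix e :: real assume "0 < e"
  define \<epsilon> where "\<epsilon> = e / 2"
  have eps: "0 < \<epsilon>" using \<open>0 < e\<close> by (simp add: \<epsilon>_def)
  define z where "z n = max 0 (\<bar>v n - b / c\<bar> - \<epsilon>)" for n
  obtain K where K: "\<And>n. n \<ge> K \<Longrightarrow> \<bar>real n * (v (Suc n) - v n) + c * v n - b\<bar> < c * \<epsilon>"
    using LIMSEQ_D[OF drift, of "c * \<epsilon>"] c eps by (auto simp: real_norm_def)
  \<comment> \<open>from \<open>n \<ge> c\<close> on, the factor \<open>1 - c/n\<close> is nonnegative\<close>
  define N where "N = max K (max 1 (nat \<lceil>c\<rceil>))"
  have decay: "z (Suc n) * real (Suc n) powr c \<le> z n * real n powr c" if "n \<ge> N" for n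
  proof -
    have n: "n \<ge> K" "0 < real n" "c \<le> real n" using that by (auto simp: N_def)
    define d where "d = real n * (v (Suc n) - v n) + c * v n - b"
    have "v (Suc n) - b / c = (1 - c / n) * (v n - b / c) + d / n"
      using n c by (simp add: d_def field_simps)
    then have "\<bar>v (Suc n) - b / c\<bar> \<le> \<bar>(1 - c / n) * (v n - b / c)\<bar> + \<bar>d / n\<bar>"
      by (metis abs_triangle_ineq)
    also have "\<bar>(1 - c / n) * (v n - b / c)\<bar> = (1 - c / n) * \<bar>v n - b / c\<bar>"
      using n by (simp add: abs_mult)
    also have "\<bar>d / n\<bar> \<le> (c / n) * \<epsilon>"
      using K[OF n(1)] n by (simp add: d_def[symmetric] divide_right_mono less_imp_le)
    finally have "\<bar>v (Suc n) - b / c\<bar> - \<epsilon> \<le> (1 - c / n) * (\<bar>v n - b / c\<bar> - \<epsilon>)"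
      by (simp add: algebra_simps)
    also have "\<dots> \<le> (1 - c / n) * z n" using n by (intro mult_left_mono) (auto simp: z_def)
    finally have z: "z (Suc n) \<le> (1 - c / n) * z n" using n by (auto simp: z_def)
    have "1 - c / n \<le> exp (- (c / n))" using exp_ge_add_one_self[of "- (c / n)"] by simp
    also have "\<dots> \<le> exp (- (c * ln (1 + 1 / n)))"
      using ln_add_one_self_le_self[of "1 / real n"] n c mult_left_mono[of "ln (1 + 1 / n)" "1 / n" c] by auto
    also have "\<dots> = real n powr c / real (Suc n) powr c"
    proof -
      have "ln (1 + 1 / n) = ln (real (Suc n)) - ln (real n)"
      proof -
        have "1 + 1 / real n = real (Suc n) / real n" using n by (simp add: field_simps)
        then show ?thesis using n ln_div[of "real (Suc n)" "real n"] by simp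
      qed
      then show ?thesis using n by (simp add: powr_def exp_diff[symmetric] right_diff_distrib)
    qed
    finally have "1 - c / n \<le> real n powr c / real (Suc n) powr c" .
    then have "z (Suc n) \<le> real n powr c / real (Suc n) powr c * z n"
      using z mult_right_mono[of "1 - c / n" _ "z n"] by (force simp: z_def)
    then show ?thesis by (simp add: pos_le_divide_eq mult.commute)
  qed
  have bound: "z n * real n powr c \<le> z N * real N powr c" if "n \<ge> N" for n
    using that
  proof (induction n rule: dec_induct)
    case (step k)
    from order_trans[OF decay[OF step(1)] step(3)] show ?case .
  qed simp
  have "(\<lambda>n. z N * real N powr c * real n powr (- c)) \<longlonglongrightarrow> z N * real N powr c * 0"
    using c by (intro tendsto_mult_left tendsto_neg_powr filterlim_real_sequentially) simp
  then obtain L where L: "\<And>n. n \<ge> L \<Longrightarrow> z N * real N powr c * real n powr (- c) < \<epsilon>"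
    using order_tendstoD(2)[of _ "0::real" sequentially \<epsilon>] eps by (auto simp: eventually_sequentially)
  show "\<exists>L. \<forall>n\<ge>L. norm (v n - b / c) < e"
  proof (intro exI allI impI)
    fix n assume n: "max N L \<le> n"
    then have pos: "0 < real n powr c" by (auto simp: N_def)
    have "z n * real n powr c \<le> z N * real N powr c" using n by (intro bound) simp
    then have "z n \<le> z N * real N powr c * real n powr (- c)"
      using pos by (simp add: powr_minus field_simps)
    also have "\<dots> < \<epsilon>" using n by (intro L) simp
    finally have "z n < \<epsilon>" .
    then have "\<bar>v n - b / c\<bar> < 2 * \<epsilon>" by (simp add: z_def)
    then show "norm (v n - b / c) < e" by (simp add: \<epsilon>_def)
  qed
qed

lemma null_times_bounded:
  fixes f g :: "nat \<Rightarrow> real"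
  assumes "f \<longlonglongrightarrow> 0" "\<And>n. 1 \<le> n \<Longrightarrow> \<bar>g n\<bar> \<le> 1"
  shows "(\<lambda>n. f n * g n) \<longlonglongrightarrow> 0"
proof (rule Lim_null_comparison[OF _ tendsto_rabs_zero[OF assms(1)]])
  show "\<forall>\<^sub>F n in sequentially. norm (f n * g n) \<le> \<bar>f n\<bar>"
    using eventually_ge_at_top[of "1 :: nat"]
    by eventually_elim (use assms(2) in \<open>auto simp: abs_mult intro!: mult_left_le\<close>)
qed

section \<open>One step of the empirical measure\<close>

text \<open>
  The remainder for \<open>k + 1\<close> is \<open>x + h \<le> 2\<close> times the remainder for \<open>k\<close> plus \<open>k x\<^sup>k\<^sup>-\<^sup>1 h\<^sup>2\<close>, which gives the
  crude constant \<open>k 2\<^sup>k\<close>; for the recursion only its independence of \<open>x\<close> and \<open>h\<close> matters.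
\<close>

lemma power_add_first_order:
  fixes x h :: real
  assumes "0 \<le> x" "x \<le> 1" "0 \<le> h" "h \<le> 1"
  shows "\<bar>(x + h) ^ k - x ^ k - real k * x ^ (k - 1) * h\<bar> \<le> real k * 2 ^ k * h\<^sup>2"
proof (induction k)
  case (Suc k)
  let ?R = "(x + h) ^ k - x ^ k - real k * x ^ (k - 1) * h"
  have shift: "real k * x ^ k = real k * x ^ (k - 1) * x" by (cases k) auto
  have "(x + h) ^ Suc k - x ^ Suc k - real (Suc k) * x ^ (Suc k - 1) * h =
      (x + h) * ?R + real k * x ^ (k - 1) * h\<^sup>2"
    using shift by (simp add: algebra_simps power2_eq_square) (metis mult.assoc mult.commute)
  also have "\<bar>\<dots>\<bar> \<le> \<bar>(x + h) * ?R\<bar> + \<bar>real k * x ^ (k - 1) * h\<^sup>2\<bar>" by (rule abs_triangle_ineq)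
  also have "\<bar>(x + h) * ?R\<bar> \<le> 2 * (real k * 2 ^ k * h\<^sup>2)"
    unfolding abs_mult using assms by (intro mult_mono Suc.IH) auto
  also have "\<bar>real k * x ^ (k - 1) * h\<^sup>2\<bar> \<le> 2 ^ Suc k * h\<^sup>2"
  proof -
    have "x ^ (k - 1) \<le> 1" using assms by (intro power_le_one) auto
    then have "real k * x ^ (k - 1) \<le> real k" by (simp add: mult_left_le)
    also have "\<dots> \<le> 2 ^ k" using of_nat_less_two_power[of k, where ?'a = real] by simp
    also have "\<dots> \<le> 2 ^ Suc k" by simp
    finally show ?thesis using assms by (simp add: abs_mult mult_right_mono)
  qed
  finally show ?case by (simp add: algebra_simps)
qed simp

lemma monomial_bounds:
  assumes "x \<in> prob_simplex"
  shows "0 \<le> monomial m x" "monomial m x \<le> 1"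
  using assms by (auto simp: monomial_def prob_simplex_def intro!: prod_nonneg prod_le_1 power_le_one)

text \<open>
  Only the \<open>i\<close>-th factor changes and the others are at most 1. If \<open>m i = 0\<close> the truncated subtraction
  is harmless, because the term carries the factor \<open>m i\<close>.
\<close>

lemma monomial_add_axis:
  fixes x :: "real^'d::finite"
  assumes x: "x \<in> prob_simplex" and h: "0 \<le> h" "h \<le> 1"
  shows "\<bar>monomial m (x + h *\<^sub>R axis i 1) - monomial m x -
    h * real (m i) * monomial (m(i := m i - 1)) x\<bar> \<le> real (m i) * 2 ^ m i * h\<^sup>2"
proof -
  have U: "(UNIV :: 'd set) = insert i (UNIV - {i})" by auto
  define Q where "Q = (\<Prod>k\<in>UNIV - {i}. (x $ k) ^ m k)"
  have bd: "0 \<le> x $ k" "x $ k \<le> 1" for k using x by (auto simp: prob_simplex_def)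
  have Q: "0 \<le> Q" "Q \<le> 1"
    unfolding Q_def using bd by (auto intro!: prod_nonneg prod_le_1 power_le_one)
  have "monomial m (x + h *\<^sub>R axis i 1) = (x $ i + h) ^ m i * Q"
    unfolding monomial_def Q_def
    by (subst U, subst prod.insert) (auto simp: axis_def intro!: prod.cong)
  moreover have "monomial m x = (x $ i) ^ m i * Q"
    unfolding monomial_def Q_def by (subst U, subst prod.insert) auto
  moreover have "monomial (m(i := m i - 1)) x = (x $ i) ^ (m i - 1) * Q"
    unfolding monomial_def Q_def by (subst U, subst prod.insert) (auto intro!: prod.cong)
  ultimately have "monomial m (x + h *\<^sub>R axis i 1) - monomial m x -
      h * real (m i) * monomial (m(i := m i - 1)) x =
    ((x $ i + h) ^ m i - (x $ i) ^ m i - real (m i) * (x $ i) ^ (m i - 1) * h) * Q"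
    by (simp add: algebra_simps)
  also have "\<bar>\<dots>\<bar> \<le> (real (m i) * 2 ^ m i * h\<^sup>2) * 1"
    unfolding abs_mult using Q bd h
    by (intro mult_mono power_add_first_order) auto
  finally show ?thesis by simp
qed

lemma monomial_scaleR: "monomial m (c *\<^sub>R x) = c ^ (\<Sum>k\<in>UNIV. m k) * monomial m x"
  by (simp add: monomial_def power_mult_distrib prod.distrib power_sum)

lemma empirical_measure_component:
  "empirical_measure I n \<omega> $ i = (\<Sum>k=1..n. if I k \<omega> = i then 1 else 0) / real n"
  by (simp add: empirical_measure_def axis_def eq_commute[of i])

lemma empirical_measure_in_prob_simplex:
  assumes "1 \<le> n"
  shows "empirical_measure I n \<omega> \<in> prob_simplex"
proof -
  have nonneg: "0 \<le> empirical_measure I n \<omega> $ i" for i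
    by (auto simp: empirical_measure_component intro!: divide_nonneg_nonneg sum_nonneg)
  have sum1: "(\<Sum>i\<in>UNIV. empirical_measure I n \<omega> $ i) = 1"
    using assms unfolding empirical_measure_component sum_divide_distrib[symmetric]
    by (subst sum.swap) simp
  have "empirical_measure I n \<omega> $ i \<le> 1" for i
    using member_le_sum[of i UNIV "\<lambda>i. empirical_measure I n \<omega> $ i"] nonneg sum1 by simp
  with nonneg sum1 show ?thesis by (auto simp: prob_simplex_def)
qed

lemma empirical_measure_Suc:
  assumes "1 \<le> n"
  shows "empirical_measure I (Suc n) \<omega> = (real n / real (Suc n)) *\<^sub>R
    (empirical_measure I n \<omega> + (1 / real n) *\<^sub>R axis (I (Suc n) \<omega>) 1)"
  using assms by (simp add: empirical_measure_def scaleR_add_right)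

lemma shrink_power_rate:
  "(\<lambda>n. real n * ((real n / real (Suc n)) ^ d - 1)) \<longlonglongrightarrow> - real d"
proof (induction d)
  case (Suc d)
  have r: "(\<lambda>n. real n / real (Suc n)) \<longlonglongrightarrow> 1" by (rule LIMSEQ_n_over_Suc_n)
  have "(\<lambda>n. - (real n / real (Suc n)) * (real n / real (Suc n)) ^ d +
      real n * ((real n / real (Suc n)) ^ d - 1)) \<longlonglongrightarrow> - 1 * 1 ^ d + - real d"
    by (intro tendsto_intros r Suc.IH)
  moreover have "- (real n / real (Suc n)) * (real n / real (Suc n)) ^ d +
      real n * ((real n / real (Suc n)) ^ d - 1) =
      real n * ((real n / real (Suc n)) ^ Suc d - 1)" for n
  proof -
    define \<rho> where "\<rho> = real n / real (Suc n)"
    have "real n * (\<rho> - 1) = - \<rho>" by (simp add: \<rho>_def field_simps)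
    moreover have "real n * (\<rho> ^ Suc d - 1) = real n * (\<rho> - 1) * \<rho> ^ d + real n * (\<rho> ^ d - 1)"
      by (simp add: algebra_simps)
    ultimately show ?thesis unfolding \<rho>_def by simp
  qed
  ultimately show ?case by simp
qed simp

section \<open>One step of the chain\<close>

context freezing_markov_chain
begin

definition history :: "nat \<Rightarrow> (nat \<Rightarrow> 'd) \<Rightarrow> 'a set" where
  "history n s = {\<omega> \<in> space M. \<forall>k\<in>{1..n}. I k \<omega> = s k}"

definition state_event :: "nat \<Rightarrow> 'd \<Rightarrow> 'a set" where
  "state_event n i = {\<omega> \<in> space M. I n \<omega> = i}"

lemma state_event_measurable [measurable]: "1 \<le> n \<Longrightarrow> state_event n i \<in> events"
  using measurable_sets[OF measurable_state[of n], of "{i}"]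
  by (simp add: state_event_def vimage_def Int_def conj_commute)

lemma history_measurable [measurable]: "history n s \<in> events"
proof -
  have "history n s = space M \<inter> (\<Inter>k\<in>{1..n}. state_event k (s k))"
    by (auto simp: history_def state_event_def)
  then show ?thesis
    by (cases "n = 0") (auto intro!: sets.Int sets.finite_INT state_event_measurable)
qed

lemma prob_partition:
  assumes "A \<in> events" "1 \<le> n"
  shows "prob A = (\<Sum>j\<in>UNIV. prob (A \<inter> state_event n j))"
proof -
  have "A = (\<Union>j\<in>UNIV. A \<inter> state_event n j)"
    using sets.sets_into_space[OF assms(1)] by (auto simp: state_event_def)
  then have "prob A = prob (\<Union>j\<in>UNIV. A \<inter> state_event n j)" by simp
  also have "\<dots> = (\<Sum>j\<in>UNIV. prob (A \<inter> state_event n j))"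
    using assms by (intro finite_measure_finite_Union)
      (auto simp: disjoint_family_on_def state_event_def[symmetric] intro!: sets.Int state_event_measurable,
       auto simp: state_event_def)
  finally show ?thesis .
qed

lemma freezing_rate_diagonal:
  "freezing_rate p q r n i i = - (\<Sum>k\<in>UNIV - {i}. freezing_rate p q r n i k)"
  by (simp add: freezing_rate_def)

text \<open>
  Off the diagonal this is the Markov property. The locale does not prescribe the probability of staying
  put; it follows by complement, which is why the diagonal of the rate matrix is minus the sum of the
  other entries of the row.
\<close>

lemma prob_history_step:
  assumes n: "1 \<le> n"
  shows "prob (history n s \<inter> state_event (Suc n) j) =
    prob (history n s) * (of_bool (s n = j) + freezing_rate p q r n (s n) j)"
proof -
  have off: "prob (history n s \<inter> state_event (Suc n) k) =
      prob (history n s) * freezing_rate p q r n (s n) k" if k: "k \<noteq> s n" for k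
  proof (cases "prob (history n s) = 0")
    case True
    have "prob (history n s \<inter> state_event (Suc n) k) \<le> prob (history n s)"
      by (intro finite_measure_mono) auto
    with True show ?thesis by (simp add: measure_le_0_iff)
  next
    case False
    then have pos: "0 < prob (history n s)" by (simp add: zero_less_measure_iff)
    have "prob (history n s) \<le> prob (state_event n (s n))"
      using n by (intro finite_measure_mono) (auto simp: history_def state_event_def[abs_def] intro!: state_event_measurable[unfolded state_event_def])
    with pos have pos': "0 < prob (state_event n (s n))" by linarith
    have "prob (history n s \<inter> state_event (Suc n) k) / prob (history n s) =
      \<P>(\<omega> in M. I (Suc n) \<omega> = k \<bar> \<forall>l\<in>{1..n}. I l \<omega> = s l)"
      unfolding cond_prob_def history_def state_event_def
      by (intro arg_cong2[of _ _ _ _ "(/)"] arg_cong[of _ _ prob]) auto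
    also have "\<dots> = \<P>(\<omega> in M. I (Suc n) \<omega> = k \<bar> I n \<omega> = s n)"
      using pos unfolding history_def by (intro markov_property n)
    also have "\<dots> = freezing_rate p q r n (s n) k"
      using pos' k unfolding state_event_def by (intro transition n) auto
    finally show ?thesis using pos by (simp add: field_simps)
  qed
  show ?thesis
  proof (cases "s n = j")
    case False
    then show ?thesis using off[of j] by simp
  next
    case True
    have U: "(UNIV :: 'd set) = insert j (UNIV - {j})" by auto
    have "prob (history n s) = (\<Sum>k\<in>UNIV. prob (history n s \<inter> state_event (Suc n) k))"
      by (rule prob_partition) auto
    also have "\<dots> = prob (history n s \<inter> state_event (Suc n) j) +
        (\<Sum>k\<in>UNIV - {j}. prob (history n s \<inter> state_event (Suc n) k))"
      by (subst U, subst sum.insert) auto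
    also have "(\<Sum>k\<in>UNIV - {j}. prob (history n s \<inter> state_event (Suc n) k)) =
        (\<Sum>k\<in>UNIV - {j}. prob (history n s) * freezing_rate p q r n j k)"
      using True by (intro sum.cong) (auto simp: off)
    also have "\<dots> = - (prob (history n s) * freezing_rate p q r n j j)"
      by (simp add: freezing_rate_diagonal sum_distrib_left)
    finally show ?thesis using True by (simp add: algebra_simps)
  qed
qed

text \<open>
  There are finitely many histories of length \<open>n\<close>, and they partition the space, so the Markov property,
  which is stated for single histories, can be applied to each term of a finite sum.
\<close>

lemma expectation_history:
  fixes \<Phi> :: "(nat \<Rightarrow> 'd) \<Rightarrow> real"
  assumes dep: "\<And>s s'. (\<And>k. k \<in> {1..n} \<Longrightarrow> s k = s' k) \<Longrightarrow> \<Phi> s = \<Phi> s'"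
    and A [measurable]: "A \<in> events"
  shows "expectation (\<lambda>\<omega>. \<Phi> (\<lambda>k. I k \<omega>) * indicator A \<omega>) =
    (\<Sum>s\<in>PiE {1..n} (\<lambda>_. UNIV). \<Phi> s * prob (history n s \<inter> A))"
proof -
  let ?H = "PiE {1..n} (\<lambda>_. UNIV :: 'd set)"
  have fin: "finite ?H" by (intro finite_PiE) auto
  have "\<Phi> (\<lambda>k. I k \<omega>) * indicator A \<omega> = (\<Sum>s\<in>?H. \<Phi> s * indicator (history n s \<inter> A) \<omega>)"
    if \<omega>: "\<omega> \<in> space M" for \<omega>
  proof -
    let ?s = "restrict (\<lambda>k. I k \<omega>) {1..n}"
    have "indicator (history n s \<inter> A) \<omega> = (if s = ?s then indicator A \<omega> else 0 :: real)"
      if "s \<in> ?H" for s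
    proof -
      have "\<omega> \<in> history n s \<longleftrightarrow> s = ?s"
      proof
        assume "\<omega> \<in> history n s"
        then show "s = ?s" using that by (intro PiE_ext[of s "{1..n}"]) (auto simp: history_def)
      qed (use \<omega> in \<open>auto simp: history_def\<close>)
      then show ?thesis by (auto simp: indicator_def)
    qed
    then have "(\<Sum>s\<in>?H. \<Phi> s * indicator (history n s \<inter> A) \<omega>) =
        (\<Sum>s\<in>?H. if s = ?s then \<Phi> ?s * indicator A \<omega> else 0)"
      by (intro sum.cong) auto
    also have "\<dots> = \<Phi> ?s * indicator A \<omega>" using fin by (subst sum.delta) auto
    also have "\<Phi> ?s = \<Phi> (\<lambda>k. I k \<omega>)" by (rule dep) auto
    finally show ?thesis by simp
  qed
  then have "expectation (\<lambda>\<omega>. \<Phi> (\<lambda>k. I k \<omega>) * indicator A \<omega>) =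
      expectation (\<lambda>\<omega>. \<Sum>s\<in>?H. \<Phi> s * indicator (history n s \<inter> A) \<omega>)"
    by (intro Bochner_Integration.integral_cong) auto
  also have "\<dots> = (\<Sum>s\<in>?H. expectation (\<lambda>\<omega>. \<Phi> s * indicator (history n s \<inter> A) \<omega>))"
    by (intro Bochner_Integration.integral_sum integrable_mult_right integrable_real_indicator)
       (auto simp: less_top[symmetric])
  also have "\<dots> = (\<Sum>s\<in>?H. \<Phi> s * prob (history n s \<inter> A))"
    using sets.sets_into_space[OF A] by (intro sum.cong) (auto simp: Int_absorb2)
  finally show ?thesis .
qed

lemma expectation_step:
  fixes \<Phi> :: "(nat \<Rightarrow> 'd) \<Rightarrow> real"
  assumes n: "1 \<le> n" and dep: "\<And>s s'. (\<And>k. k \<in> {1..n} \<Longrightarrow> s k = s' k) \<Longrightarrow> \<Phi> s = \<Phi> s'"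
  shows "expectation (\<lambda>\<omega>. \<Phi> (\<lambda>k. I k \<omega>) * indicator (state_event (Suc n) i) \<omega>) =
    (\<Sum>j\<in>UNIV. expectation (\<lambda>\<omega>. \<Phi> (\<lambda>k. I k \<omega>) * indicator (state_event n j) \<omega>) *
       (of_bool (j = i) + freezing_rate p q r n j i))"
proof -
  let ?H = "PiE {1..n} (\<lambda>_. UNIV :: 'd set)"
  let ?T = "\<lambda>j. of_bool (j = i) + freezing_rate p q r n j i"
  have "history n s \<inter> state_event n j = (if j = s n then history n s else {})" for s j
    using n by (auto simp: history_def state_event_def)
  then have "expectation (\<lambda>\<omega>. \<Phi> (\<lambda>k. I k \<omega>) * indicator (state_event n j) \<omega>) =
      (\<Sum>s\<in>?H. if j = s n then \<Phi> s * prob (history n s) else 0)" for j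
    using n by (subst expectation_history[OF dep]) (auto intro!: sum.cong)
  then have "(\<Sum>j\<in>UNIV. expectation (\<lambda>\<omega>. \<Phi> (\<lambda>k. I k \<omega>) * indicator (state_event n j) \<omega>) * ?T j) =
      (\<Sum>j\<in>UNIV. \<Sum>s\<in>?H. if j = s n then \<Phi> s * prob (history n s) * ?T j else 0)"
    by (auto simp: sum_distrib_right intro!: sum.cong)
  also have "\<dots> = (\<Sum>s\<in>?H. \<Phi> s * prob (history n s) * ?T (s n))"
    by (subst sum.swap) simp
  also have "\<dots> = (\<Sum>s\<in>?H. \<Phi> s * prob (history n s \<inter> state_event (Suc n) i))"
    using n by (simp add: prob_history_step mult.assoc)
  also have "\<dots> = expectation (\<lambda>\<omega>. \<Phi> (\<lambda>k. I k \<omega>) * indicator (state_event (Suc n) i) \<omega>)"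
    using n by (subst expectation_history[OF dep]) auto
  finally show ?thesis by simp
qed

section \<open>The moment recursion\<close>

lemma empirical_measure_measurable [measurable]: "empirical_measure I n \<in> borel_measurable M"
proof -
  have "(\<lambda>\<omega>. axis (I k \<omega>) 1 :: real^'d) \<in> borel_measurable M" if "k \<in> {1..n}" for k
    using that by (intro measurable_compose[OF measurable_state borel_measurable_count_space]) simp
  then show ?thesis
    unfolding empirical_measure_def[abs_def]
    by (intro borel_measurable_scaleR borel_measurable_const borel_measurable_sum)
qed

definition state_moment :: "('d \<Rightarrow> nat) \<Rightarrow> nat \<Rightarrow> 'd \<Rightarrow> real" where
  "state_moment m n i =
     expectation (\<lambda>\<omega>. monomial m (empirical_measure I n \<omega>) * indicator (state_event n i) \<omega>)"

definition next_state_moment :: "('d \<Rightarrow> nat) \<Rightarrow> nat \<Rightarrow> 'd \<Rightarrow> real" where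
  "next_state_moment m n i =
     expectation (\<lambda>\<omega>. monomial m (empirical_measure I n \<omega>) * indicator (state_event (Suc n) i) \<omega>)"

lemma monomial_empirical_measure_bounds:
  assumes "1 \<le> n"
  shows "0 \<le> monomial m (empirical_measure I n \<omega>)" "monomial m (empirical_measure I n \<omega>) \<le> 1"
  by (intro monomial_bounds empirical_measure_in_prob_simplex assms)+

lemma integrable_monomial_indicator:
  assumes "1 \<le> n" "A \<in> events"
  shows "integrable M (\<lambda>\<omega>. monomial m (empirical_measure I n \<omega>) * indicator A \<omega>)"
proof (rule integrable_const_bound[where B = 1])
  show "AE \<omega> in M. norm (monomial m (empirical_measure I n \<omega>) * indicator A \<omega>) \<le> 1"
    using monomial_empirical_measure_bounds[OF assms(1)]
    by (intro AE_I2) (simp add: indicator_def)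
  show "(\<lambda>\<omega>. monomial m (empirical_measure I n \<omega>) * indicator A \<omega>) \<in> borel_measurable M"
    using assms(2) by (intro borel_measurable_times borel_measurable_indicator
        measurable_compose[OF empirical_measure_measurable monomial_measurable])
qed

lemma expectation_monomial_indicator_bounds:
  assumes "1 \<le> n" "A \<in> events"
  shows "\<bar>expectation (\<lambda>\<omega>. monomial m (empirical_measure I n \<omega>) * indicator A \<omega>)\<bar> \<le> 1"
proof -
  note b = monomial_empirical_measure_bounds[OF assms(1)]
  have "expectation (\<lambda>\<omega>. monomial m (empirical_measure I n \<omega>) * indicator A \<omega>) \<le> expectation (\<lambda>_. 1)"
  proof (rule integral_mono)
    show "integrable M (\<lambda>\<omega>. monomial m (empirical_measure I n \<omega>) * indicator A \<omega>)"
      by (rule integrable_monomial_indicator[OF assms])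
    show "integrable M (\<lambda>_. 1 :: real)" by simp
    show "monomial m (empirical_measure I n \<omega>) * indicator A \<omega> \<le> (1 :: real)" for \<omega>
      using b(2) by (cases "\<omega> \<in> A") simp_all
  qed
  moreover have "0 \<le> expectation (\<lambda>\<omega>. monomial m (empirical_measure I n \<omega>) * indicator A \<omega>)"
    by (intro Bochner_Integration.integral_nonneg mult_nonneg_nonneg b) simp
  ultimately show ?thesis by (simp add: prob_space)
qed

lemma state_moment_bound: "1 \<le> n \<Longrightarrow> \<bar>state_moment m n i\<bar> \<le> 1"
  unfolding state_moment_def by (intro expectation_monomial_indicator_bounds) auto

lemma next_state_moment_bound: "1 \<le> n \<Longrightarrow> \<bar>next_state_moment m n i\<bar> \<le> 1"
  unfolding next_state_moment_def by (intro expectation_monomial_indicator_bounds) auto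

lemma next_state_moment_eq:
  assumes "1 \<le> n"
  shows "next_state_moment m n i =
    (\<Sum>j\<in>UNIV. state_moment m n j * (of_bool (j = i) + freezing_rate p q r n j i))"
proof -
  let ?\<Phi> = "\<lambda>s. monomial m (empirical_measure (\<lambda>k _. s k) n ())"
  have dep: "?\<Phi> s = ?\<Phi> s'" if "\<And>k. k \<in> {1..n} \<Longrightarrow> s k = s' k" for s s'
  proof -
    have "(\<Sum>k=1..n. axis (s k) 1 :: real^'d) = (\<Sum>k=1..n. axis (s' k) 1)"
      using that by (intro sum.cong) auto
    then show ?thesis by (simp add: empirical_measure_def)
  qed
  have "empirical_measure I n \<omega> = empirical_measure (\<lambda>k _. I k \<omega>) n ()" for \<omega>
    by (simp add: empirical_measure_def)
  then show ?thesis
    unfolding next_state_moment_def state_moment_def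
    using expectation_step[OF assms, where \<Phi> = ?\<Phi> and i = i, OF dep] by simp
qed

text \<open>
  On the event \<open>I (Suc n) = i\<close> the empirical measure moves by a scaled \<open>axis i 1\<close>, so
  \<open>monomial_add_axis\<close> applies pointwise with \<open>h = 1/n\<close>; the factor in front comes from homogeneity of
  the monomial.
\<close>

lemma state_moment_Suc:
  fixes m :: "'d \<Rightarrow> nat"
  assumes n: "1 \<le> n"
  shows "\<bar>state_moment m (Suc n) i - (real n / real (Suc n)) ^ (\<Sum>k\<in>UNIV. m k) *
      (next_state_moment m n i + real (m i) / real n * next_state_moment (m(i := m i - 1)) n i)\<bar>
    \<le> real (m i) * 2 ^ m i / (real n)\<^sup>2"
proof -
  let ?x = "empirical_measure I n" and ?A = "state_event (Suc n) i"
  let ?\<rho> = "(real n / real (Suc n)) ^ (\<Sum>k\<in>UNIV. m k)"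
  let ?m = "m(i := m i - 1)" and ?C = "real (m i) * 2 ^ m i / (real n)\<^sup>2"
  have \<rho>: "0 \<le> ?\<rho>" "?\<rho> \<le> 1" by (auto intro!: power_le_one)
  have int: "integrable M (\<lambda>\<omega>. monomial m (?x \<omega>) * indicator ?A \<omega>)"
    "integrable M (\<lambda>\<omega>. monomial ?m (?x \<omega>) * indicator ?A \<omega>)"
    "integrable M (\<lambda>\<omega>. monomial m (empirical_measure I (Suc n) \<omega>) * indicator ?A \<omega>)"
    using n by (auto intro!: integrable_monomial_indicator)
  let ?D = "\<lambda>\<omega>. monomial m (empirical_measure I (Suc n) \<omega>) * indicator ?A \<omega> -
      ?\<rho> * (monomial m (?x \<omega>) * indicator ?A \<omega> +
        real (m i) / real n * (monomial ?m (?x \<omega>) * indicator ?A \<omega>))"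
  have intD: "integrable M ?D"
    using int by (intro Bochner_Integration.integrable_diff Bochner_Integration.integrable_add
        integrable_mult_right)
  have pt: "\<bar>?D \<omega>\<bar> \<le> ?C" for \<omega>
  proof (cases "\<omega> \<in> ?A")
    case True
    then have Ii: "I (Suc n) \<omega> = i" by (simp add: state_event_def)
    have "?D \<omega> = ?\<rho> * (monomial m (?x \<omega> + (1 / real n) *\<^sub>R axis i 1) - monomial m (?x \<omega>) -
        1 / real n * real (m i) * monomial ?m (?x \<omega>))"
      using True unfolding empirical_measure_Suc[OF n] monomial_scaleR Ii by (simp add: algebra_simps)
    also have "\<bar>\<dots>\<bar> \<le> 1 * (real (m i) * 2 ^ m i * (1 / real n)\<^sup>2)"
      unfolding abs_mult[of ?\<rho>] using n \<rho>
      by (intro mult_mono monomial_add_axis empirical_measure_in_prob_simplex n) auto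
    finally show ?thesis by (simp add: power_divide)
  qed simp
  have "\<bar>expectation ?D\<bar> \<le> expectation (\<lambda>\<omega>. \<bar>?D \<omega>\<bar>)" by (rule integral_abs_bound)
  also have "\<dots> \<le> expectation (\<lambda>_. ?C)"
    using pt by (intro integral_mono integrable_abs intD) auto
  finally have "\<bar>expectation ?D\<bar> \<le> ?C" by (simp add: prob_space)
  moreover have "expectation ?D = state_moment m (Suc n) i - ?\<rho> *
      (next_state_moment m n i + real (m i) / real n * next_state_moment ?m n i)"
    unfolding state_moment_def next_state_moment_def
    using int by (simp add: Bochner_Integration.integral_diff Bochner_Integration.integral_add
        Bochner_Integration.integrable_add)
  ultimately show ?thesis by simp
qed

text \<open>
  Off the diagonal \<open>r\<close> vanishes in the limit; the diagonal follows because the rows of \<open>q\<close> and of the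
  rate matrix both sum to 0.
\<close>

lemma scaled_freezing_rate_limit:
  assumes row_sums: "\<And>i. (\<Sum>k\<in>UNIV. q $ i $ k) = 0"
    and p_rate: "(\<lambda>n. real n * p n) \<longlonglongrightarrow> a"
  shows "(\<lambda>n. real n * freezing_rate p q r n j i) \<longlonglongrightarrow> a * q $ j $ i"
proof -
  have off: "(\<lambda>n. real n * freezing_rate p q r n j k) \<longlonglongrightarrow> a * q $ j $ k" if "j \<noteq> k" for k
  proof -
    have "(\<lambda>n. real n * p n * (q $ j $ k + r n j k)) \<longlonglongrightarrow> a * (q $ j $ k + 0)"
      by (intro tendsto_intros p_rate r_vanishes that)
    then show ?thesis using that by (simp add: freezing_rate_def mult.assoc)
  qed
  show ?thesis
  proof (cases "i = j")
    case True
    have U: "(UNIV :: 'd set) = insert j (UNIV - {j})" by auto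
    have "q $ j $ j = - (\<Sum>k\<in>UNIV - {j}. q $ j $ k)"
      using row_sums[of j] by (subst (asm) U, subst (asm) sum.insert) auto
    moreover have "(\<lambda>n. - (\<Sum>k\<in>UNIV - {j}. real n * freezing_rate p q r n j k)) \<longlonglongrightarrow>
        - (\<Sum>k\<in>UNIV - {j}. a * q $ j $ k)"
      by (intro tendsto_intros off) auto
    ultimately show ?thesis
      using True by (simp add: freezing_rate_diagonal sum_distrib_left)
  qed (use off in auto)
qed

text \<open>
  The increment of the moment, multiplied by \<open>n\<close>, has three contributions: the shrinking factor
  \<open>(n/(n+1))\<^sup>d\<close> contributes \<open>-d u\<close>, the new sample point contributes the lower moment, and the transition of
  the chain contributes the generator \<open>a q\<close>. Everything else is a bounded sequence times a null
  sequence; in particular the one-step-ahead moments may be replaced by the current ones.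
\<close>

lemma state_moment_drift:
  fixes m :: "'d \<Rightarrow> nat"
  assumes row_sums: "\<And>i. (\<Sum>k\<in>UNIV. q $ i $ k) = 0"
    and p_rate: "(\<lambda>n. real n * p n) \<longlonglongrightarrow> a"
  shows "(\<lambda>n. real n * (state_moment m (Suc n) i - state_moment m n i) +
      real (\<Sum>k\<in>UNIV. m k) * state_moment m n i - real (m i) * state_moment (m(i := m i - 1)) n i -
      a * (\<Sum>j\<in>UNIV. state_moment m n j * q $ j $ i)) \<longlonglongrightarrow> 0"
proof -
  define d where "d = (\<Sum>k\<in>UNIV. m k)"
  define m' where "m' = m(i := m i - 1)"
  define \<rho> where "\<rho> n = (real n / real (Suc n)) ^ d" for n
  define \<epsilon> where "\<epsilon> n = state_moment m (Suc n) i -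
    \<rho> n * (next_state_moment m n i + real (m i) / real n * next_state_moment m' n i)" for n
  have \<rho>1: "(\<lambda>n. \<rho> n - 1) \<longlonglongrightarrow> 0"
    using tendsto_diff[OF tendsto_power[OF LIMSEQ_n_over_Suc_n] tendsto_const, of d 1]
    by (simp add: \<rho>_def)
  have rate: "(\<lambda>n. real n * (next_state_moment l n i - state_moment l n i) -
      a * (\<Sum>j\<in>UNIV. state_moment l n j * q $ j $ i)) \<longlonglongrightarrow> 0" for l
  proof -
    have "(\<lambda>n. \<Sum>j\<in>UNIV. (real n * freezing_rate p q r n j i - a * q $ j $ i) * state_moment l n j)
        \<longlonglongrightarrow> (\<Sum>j\<in>(UNIV :: 'd set). 0)"
      by (intro tendsto_sum null_times_bounded state_moment_bound)
         (auto intro!: LIM_zero scaled_freezing_rate_limit[OF row_sums p_rate])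
    moreover have "eventually (\<lambda>n. (\<Sum>j\<in>UNIV. (real n * freezing_rate p q r n j i - a * q $ j $ i) *
        state_moment l n j) = real n * (next_state_moment l n i - state_moment l n i) -
      a * (\<Sum>j\<in>UNIV. state_moment l n j * q $ j $ i)) sequentially"
      using eventually_ge_at_top[of "1 :: nat"]
    proof eventually_elim
      case (elim n)
      have "next_state_moment l n i = state_moment l n i +
          (\<Sum>j\<in>UNIV. state_moment l n j * freezing_rate p q r n j i)"
        unfolding next_state_moment_eq[OF elim] by (simp add: distrib_left sum.distrib)
      moreover have "(\<Sum>j\<in>UNIV. (real n * freezing_rate p q r n j i - a * q $ j $ i) * state_moment l n j) =
          (\<Sum>j\<in>UNIV. real n * (state_moment l n j * freezing_rate p q r n j i) -
            a * (state_moment l n j * q $ j $ i))"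
        by (intro sum.cong) (auto simp: algebra_simps)
      ultimately show ?case by (simp add: sum_distrib_left[symmetric] sum_subtractf)
    qed
    ultimately have "(\<lambda>n. real n * (next_state_moment l n i - state_moment l n i) -
      a * (\<Sum>j\<in>UNIV. state_moment l n j * q $ j $ i)) \<longlonglongrightarrow> (\<Sum>j\<in>(UNIV :: 'd set). 0)"
      by (rule Lim_transform_eventually)
    then show ?thesis by simp
  qed
  have diff: "(\<lambda>n. next_state_moment l n i - state_moment l n i) \<longlonglongrightarrow> 0" for l
  proof -
    have inv: "(\<lambda>n. 1 / real n) \<longlonglongrightarrow> 0" by (rule lim_1_over_n)
    have "(\<lambda>n. (1 / real n) * (real n * (next_state_moment l n i - state_moment l n i) -
        a * (\<Sum>j\<in>UNIV. state_moment l n j * q $ j $ i)) +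
        a * (\<Sum>j\<in>UNIV. q $ j $ i * ((1 / real n) * state_moment l n j))) \<longlonglongrightarrow>
        0 * 0 + a * (\<Sum>j\<in>UNIV. q $ j $ i * 0)"
      by (intro tendsto_intros inv rate null_times_bounded state_moment_bound) auto
    moreover have "eventually (\<lambda>n. (1 / real n) * (real n * (next_state_moment l n i - state_moment l n i) -
        a * (\<Sum>j\<in>UNIV. state_moment l n j * q $ j $ i)) +
        a * (\<Sum>j\<in>UNIV. q $ j $ i * ((1 / real n) * state_moment l n j)) =
      next_state_moment l n i - state_moment l n i) sequentially"
      using eventually_ge_at_top[of "1 :: nat"]
    proof eventually_elim
      case (elim n)
      have "(\<Sum>j\<in>UNIV. q $ j $ i * ((1 / real n) * state_moment l n j)) =
          (1 / real n) * (\<Sum>j\<in>UNIV. state_moment l n j * q $ j $ i)"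
        by (simp add: sum_distrib_left ac_simps)
      then show ?case using elim by (simp add: field_simps)
    qed
    ultimately have "(\<lambda>n. next_state_moment l n i - state_moment l n i) \<longlonglongrightarrow>
        0 * 0 + a * (\<Sum>j\<in>UNIV. q $ j $ i * 0)"
      by (rule Lim_transform_eventually)
    then show ?thesis by simp
  qed
  have err: "(\<lambda>n. real n * \<epsilon> n) \<longlonglongrightarrow> 0"
  proof (rule Lim_null_comparison)
    show "(\<lambda>n. real (m i) * 2 ^ m i * (1 / real n)) \<longlonglongrightarrow> 0"
      by (intro tendsto_mult_right_zero lim_1_over_n)
    show "\<forall>\<^sub>F n in sequentially. norm (real n * \<epsilon> n) \<le> real (m i) * 2 ^ m i * (1 / real n)"
      using eventually_ge_at_top[of "1 :: nat"]
    proof eventually_elim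
      case (elim n)
      have "real n * \<bar>\<epsilon> n\<bar> \<le> real n * (real (m i) * 2 ^ m i / (real n)\<^sup>2)"
        using state_moment_Suc[OF elim, of m i]
        unfolding \<epsilon>_def \<rho>_def d_def m'_def by (intro mult_left_mono) auto
      then show ?case using elim by (simp add: abs_mult power2_eq_square)
    qed
  qed
  have \<rho>d: "(\<lambda>n. real n * (\<rho> n - 1) + real d) \<longlonglongrightarrow> 0"
    using tendsto_add[OF shrink_power_rate[of d] tendsto_const[of "real d"]] by (simp add: \<rho>_def)
  \<comment> \<open>the claimed expression, decomposed into the error of the expansion, the shrinking factor, the change of state, and the lower moment\<close>
  have "(\<lambda>n. real n * \<epsilon> n
      + (real n * (\<rho> n - 1) + real d) * next_state_moment m n i
      - real d * (next_state_moment m n i - state_moment m n i)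
      + (real n * (next_state_moment m n i - state_moment m n i)
          - a * (\<Sum>j\<in>UNIV. state_moment m n j * q $ j $ i))
      + real (m i) * ((\<rho> n - 1) * next_state_moment m' n i
          + (next_state_moment m' n i - state_moment m' n i)))
    \<longlonglongrightarrow> 0 + 0 - real d * 0 + 0 + real (m i) * (0 + 0)"
    by (intro tendsto_add tendsto_diff tendsto_mult tendsto_const err rate diff
        null_times_bounded \<rho>d \<rho>1 next_state_moment_bound)
  moreover have "eventually (\<lambda>n. real n * \<epsilon> n
      + (real n * (\<rho> n - 1) + real d) * next_state_moment m n i
      - real d * (next_state_moment m n i - state_moment m n i)
      + (real n * (next_state_moment m n i - state_moment m n i)
          - a * (\<Sum>j\<in>UNIV. state_moment m n j * q $ j $ i))
      + real (m i) * ((\<rho> n - 1) * next_state_moment m' n i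
          + (next_state_moment m' n i - state_moment m' n i)) =
      real n * (state_moment m (Suc n) i - state_moment m n i) +
      real d * state_moment m n i - real (m i) * state_moment m' n i -
      a * (\<Sum>j\<in>UNIV. state_moment m n j * q $ j $ i)) sequentially"
    using eventually_ge_at_top[of "1 :: nat"]
  proof eventually_elim
    case (elim n)
    define y where "y = real (m i) / real n * next_state_moment m' n i"
    have y: "real n * y = real (m i) * next_state_moment m' n i"
      using elim by (simp add: y_def)
    have "real n * \<epsilon> n = real n * state_moment m (Suc n) i - \<rho> n * (real n * next_state_moment m n i) -
        \<rho> n * (real n * y)"
      unfolding \<epsilon>_def y_def[symmetric] by (simp only: algebra_simps)
    then have "real n * \<epsilon> n = real n * state_moment m (Suc n) i - \<rho> n * (real n * next_state_moment m n i) -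
        \<rho> n * (real (m i) * next_state_moment m' n i)"
      unfolding y .
    then show ?case by (simp add: algebra_simps)
  qed
  ultimately have "(\<lambda>n. real n * (state_moment m (Suc n) i - state_moment m n i) +
      real d * state_moment m n i - real (m i) * state_moment m' n i -
      a * (\<Sum>j\<in>UNIV. state_moment m n j * q $ j $ i)) \<longlonglongrightarrow> 0 + 0 - real d * 0 + 0 + real (m i) * (0 + 0)"
    by (rule Lim_transform_eventually)
  then show ?thesis by (simp add: d_def m'_def)
qed

lemma sum_state_moment:
  assumes "1 \<le> n"
  shows "(\<Sum>i\<in>UNIV. state_moment m n i) = expectation (\<lambda>\<omega>. monomial m (empirical_measure I n \<omega>))"
proof -
  have "(\<Sum>i\<in>UNIV. state_moment m n i) =
      expectation (\<lambda>\<omega>. \<Sum>i\<in>UNIV. monomial m (empirical_measure I n \<omega>) * indicator (state_event n i) \<omega>)"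
    unfolding state_moment_def using assms
    by (intro Bochner_Integration.integral_sum[symmetric] integrable_monomial_indicator) auto
  also have "\<dots> = expectation (\<lambda>\<omega>. monomial m (empirical_measure I n \<omega>))"
    by (intro Bochner_Integration.integral_cong)
       (auto simp: sum_distrib_left[symmetric] state_event_def indicator_def sum.delta)
  finally show ?thesis .
qed

end

section \<open>Limits of the moments\<close>

text \<open>
  Here the rate of jumping to \<open>j\<close> does not depend on the present state (parent-independent mutation in
  population genetics). This is what makes the moment recursion close on the total moments.
\<close>

locale mutation_freezing_chain = freezing_markov_chain M p q r I
  for M :: "'a measure" and p q r and I :: "nat \<Rightarrow> 'a \<Rightarrow> 'd::finite" +
  fixes \<theta> :: "real^'d" and a :: real
  assumes theta_pos: "\<And>j. 0 < \<theta> $ j"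
    and q_eq: "\<And>i j. q $ i $ j = \<theta> $ j - (if i = j then (\<Sum>k\<in>UNIV. \<theta> $ k) else 0)"
    and a_pos: "0 < a"
    and p_rate: "(\<lambda>n. real n * p n) \<longlonglongrightarrow> a"
begin

abbreviation total_weight :: real where "total_weight \<equiv> a * (\<Sum>k\<in>UNIV. \<theta> $ k)"

definition weight_product :: "('d \<Rightarrow> nat) \<Rightarrow> real" where
  "weight_product m = (\<Prod>k\<in>UNIV. pochhammer (a * \<theta> $ k) (m k))"

lemma total_weight_pos: "0 < total_weight"
  using theta_pos a_pos by (intro mult_pos_pos sum_pos) auto

text \<open>
  The generator acts on the vector of moments as \<open>\<theta>\<^sub>i\<close> times the total minus \<open>|\<theta>|\<close> times the moment, so
  it contributes to the damping as well as to the forcing.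
\<close>

lemma state_moment_recursion:
  "(\<lambda>n. real n * (state_moment m (Suc n) i - state_moment m n i) +
      (real (\<Sum>k\<in>UNIV. m k) + total_weight) * state_moment m n i -
      real (m i) * state_moment (m(i := m i - 1)) n i -
      a * \<theta> $ i * (\<Sum>j\<in>UNIV. state_moment m n j)) \<longlonglongrightarrow> 0"
proof -
  have row_sums: "(\<Sum>k\<in>UNIV. q $ i $ k) = 0" for i by (simp add: q_eq sum_subtractf)
  have generator: "a * (\<Sum>j\<in>UNIV. state_moment m n j * q $ j $ i) =
      a * \<theta> $ i * (\<Sum>j\<in>UNIV. state_moment m n j) - total_weight * state_moment m n i" for n
  proof -
    have "state_moment m n j * q $ j $ i = \<theta> $ i * state_moment m n j -
        (if j = i then (\<Sum>k\<in>UNIV. \<theta> $ k) * state_moment m n i else 0)" for j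
      by (simp add: q_eq algebra_simps)
    then have "(\<Sum>j\<in>UNIV. state_moment m n j * q $ j $ i) =
        \<theta> $ i * (\<Sum>j\<in>UNIV. state_moment m n j) - (\<Sum>k\<in>UNIV. \<theta> $ k) * state_moment m n i"
      by (simp add: sum_subtractf sum_distrib_left[symmetric])
    then show ?thesis by (simp only: right_diff_distrib mult.assoc)
  qed
  show ?thesis
    using state_moment_drift[OF row_sums p_rate, of m i] unfolding generator
    by (simp add: algebra_simps)
qed

text \<open>
  Summed over the states, the contribution of the generator cancels and only the damping \<open>|m|\<close> remains;
  it is positive precisely when \<open>m\<close> is not 0. All lower moments enter with the same limit \<open>L\<close>, so their
  weights \<open>m\<^sub>i\<close> add up to \<open>|m|\<close> and divide out.
\<close>

lemma total_moment_limit: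
  assumes pos: "0 < (\<Sum>k\<in>UNIV. m k)"
    and lower: "\<And>i. (\<lambda>n. real (m i) * state_moment (m(i := m i - 1)) n i) \<longlonglongrightarrow> real (m i) * L"
  shows "(\<lambda>n. \<Sum>i\<in>UNIV. state_moment m n i) \<longlonglongrightarrow> L"
proof -
  let ?U = "\<lambda>n. \<Sum>i\<in>UNIV. state_moment m n i" and ?d = "real (\<Sum>k\<in>UNIV. m k)"
  let ?drift = "\<lambda>n i. real n * (state_moment m (Suc n) i - state_moment m n i) +
      (?d + total_weight) * state_moment m n i -
      real (m i) * state_moment (m(i := m i - 1)) n i - a * \<theta> $ i * ?U n"
  have "(\<lambda>n. (\<Sum>i\<in>UNIV. ?drift n i) + (\<Sum>i\<in>UNIV. real (m i) * state_moment (m(i := m i - 1)) n i))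
      \<longlonglongrightarrow> (\<Sum>i\<in>(UNIV :: 'd set). 0) + (\<Sum>i\<in>UNIV. real (m i) * L)"
    by (intro tendsto_add tendsto_sum state_moment_recursion lower)
  moreover have "(\<Sum>i\<in>UNIV. ?drift n i) + (\<Sum>i\<in>UNIV. real (m i) * state_moment (m(i := m i - 1)) n i) =
      real n * (?U (Suc n) - ?U n) + ?d * ?U n" for n
  proof -
    have "(\<Sum>i\<in>UNIV. a * \<theta> $ i * ?U n) = total_weight * ?U n"
      unfolding sum_distrib_right[symmetric] sum_distrib_left[symmetric] ..
    then have "(\<Sum>i\<in>UNIV. ?drift n i) = real n * (?U (Suc n) - ?U n) + (?d + total_weight) * ?U n -
        (\<Sum>i\<in>UNIV. real (m i) * state_moment (m(i := m i - 1)) n i) - total_weight * ?U n"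
      by (simp add: sum.distrib sum_subtractf sum_distrib_left[symmetric] del: of_nat_sum)
    then show ?thesis by (simp add: algebra_simps)
  qed
  ultimately have "(\<lambda>n. real n * (?U (Suc n) - ?U n) + ?d * ?U n) \<longlonglongrightarrow> ?d * L"
    by (simp add: sum_distrib_right)
  moreover have d: "0 < ?d" using pos by (simp only: of_nat_0_less_iff)
  ultimately have "?U \<longlonglongrightarrow> ?d * L / ?d" by (intro stochastic_approximation_limit)
  also have "?d * L / ?d = L" using d by (intro nonzero_mult_div_cancel_left less_imp_neq[THEN not_sym])
  finally show ?thesis .
qed

lemma state_moment_limit:
  assumes lower: "\<And>i. (\<lambda>n. real (m i) * state_moment (m(i := m i - 1)) n i) \<longlonglongrightarrow> real (m i) * L"
    and total: "(\<lambda>n. \<Sum>i\<in>UNIV. state_moment m n i) \<longlonglongrightarrow> L"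
  shows "(\<lambda>n. state_moment m n i) \<longlonglongrightarrow>
    L * (a * \<theta> $ i + real (m i)) / (real (\<Sum>k\<in>UNIV. m k) + total_weight)"
proof -
  let ?d = "real (\<Sum>k\<in>UNIV. m k)"
  have "(\<lambda>n. (real n * (state_moment m (Suc n) i - state_moment m n i) +
      (?d + total_weight) * state_moment m n i -
      real (m i) * state_moment (m(i := m i - 1)) n i -
      a * \<theta> $ i * (\<Sum>j\<in>UNIV. state_moment m n j)) +
      real (m i) * state_moment (m(i := m i - 1)) n i +
      a * \<theta> $ i * (\<Sum>j\<in>UNIV. state_moment m n j)) \<longlonglongrightarrow> 0 + real (m i) * L + a * \<theta> $ i * L"
    by (intro tendsto_add tendsto_mult_left state_moment_recursion lower total)
  then have "(\<lambda>n. real n * (state_moment m (Suc n) i - state_moment m n i) +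
      (?d + total_weight) * state_moment m n i) \<longlonglongrightarrow> L * (a * \<theta> $ i + real (m i))"
    by (simp add: algebra_simps)
  moreover have "0 < ?d + total_weight" by (intro add_nonneg_pos total_weight_pos of_nat_0_le_iff)
  ultimately show ?thesis by (intro stochastic_approximation_limit)
qed

text \<open>
  The lower moments satisfy \<open>m\<^sub>i lim u\<^sub>n(m - e\<^sub>i, i) = m\<^sub>i L\<close> with an \<open>L\<close> that does not depend on \<open>i\<close>,
  because the factor \<open>a \<theta>\<^sub>i + m\<^sub>i - 1\<close> in the limit is exactly the one by which the rising factorials for \<open>m\<close>
  and \<open>m - e\<^sub>i\<close> differ. For \<open>m = 0\<close> the total moment is 1 because it is a total probability.
\<close>

lemma moment_limits:
  fixes m :: "'d \<Rightarrow> nat"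
  assumes "(\<Sum>k\<in>UNIV. m k) = d"
  shows "(\<lambda>n. \<Sum>i\<in>UNIV. state_moment m n i) \<longlonglongrightarrow> weight_product m / pochhammer total_weight d \<and>
    (\<forall>i. (\<lambda>n. state_moment m n i) \<longlonglongrightarrow>
      weight_product m * (a * \<theta> $ i + real (m i)) / pochhammer total_weight (Suc d))"
  using assms
proof (induction d arbitrary: m)
  case 0
  then have m: "m = (\<lambda>_. 0)" by auto
  have "eventually (\<lambda>n. 1 = (\<Sum>i\<in>UNIV. state_moment m n i)) sequentially"
    using eventually_ge_at_top[of "1 :: nat"]
    by eventually_elim (simp add: sum_state_moment m monomial_def prob_space)
  then have total: "(\<lambda>n. \<Sum>i\<in>UNIV. state_moment m n i) \<longlonglongrightarrow> 1"
    by (rule Lim_transform_eventually[OF tendsto_const])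
  have "(\<lambda>n. state_moment m n i) \<longlonglongrightarrow> 1 * (a * \<theta> $ i + real (m i)) / (real (\<Sum>k\<in>UNIV. m k) + total_weight)" for i
    by (rule state_moment_limit[OF _ total]) (simp add: m)
  with total show ?case by (simp add: m weight_product_def)
next
  case (Suc d)
  let ?L = "weight_product m / pochhammer total_weight (Suc d)"
  have lower: "(\<lambda>n. real (m i) * state_moment (m(i := m i - 1)) n i) \<longlonglongrightarrow> real (m i) * ?L" for i
  proof (cases "m i")
    case (Suc l)
    let ?m = "m(i := m i - 1)"
    have U: "(UNIV :: 'd set) = insert i (UNIV - {i})" by auto
    have "(\<Sum>k\<in>UNIV. m k) = Suc (\<Sum>k\<in>UNIV. ?m k)"
      using Suc by (subst (1 2) U, subst (1 2) sum.insert) auto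
    with Suc.prems have "(\<Sum>k\<in>UNIV. ?m k) = d" by simp
    with Suc.IH[of ?m] have "(\<lambda>n. state_moment ?m n i) \<longlonglongrightarrow>
        weight_product ?m * (a * \<theta> $ i + real (?m i)) / pochhammer total_weight (Suc d)" by blast
    moreover have "weight_product ?m * (a * \<theta> $ i + real (?m i)) = weight_product m"
    proof -
      have "weight_product m = pochhammer (a * \<theta> $ i) (Suc l) *
          (\<Prod>k\<in>UNIV - {i}. pochhammer (a * \<theta> $ k) (m k))"
        unfolding weight_product_def using Suc by (subst U, subst prod.insert) auto
      moreover have "weight_product ?m = pochhammer (a * \<theta> $ i) l *
          (\<Prod>k\<in>UNIV - {i}. pochhammer (a * \<theta> $ k) (m k))"
        unfolding weight_product_def using Suc by (subst U, subst prod.insert) (auto intro!: prod.cong)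
      ultimately show ?thesis using Suc by (simp add: pochhammer_Suc)
    qed
    ultimately show ?thesis by (intro tendsto_mult_left) simp
  qed simp
  have total: "(\<lambda>n. \<Sum>i\<in>UNIV. state_moment m n i) \<longlonglongrightarrow> ?L"
    using Suc.prems by (intro total_moment_limit lower) simp
  have "(\<lambda>n. state_moment m n i) \<longlonglongrightarrow> ?L * (a * \<theta> $ i + real (m i)) / (real (Suc d) + total_weight)" for i
    using state_moment_limit[OF lower total, of i] unfolding Suc.prems .
  then have "(\<lambda>n. state_moment m n i) \<longlonglongrightarrow>
      weight_product m * (a * \<theta> $ i + real (m i)) / pochhammer total_weight (Suc (Suc d))" for i
    by (simp add: pochhammer_Suc[of _ "Suc d"] add.commute divide_divide_eq_left del: of_nat_Suc)
  with total show ?case by blast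
qed

section \<open>Identification of the limit laws\<close>

definition invariant :: "real^'d" where
  "invariant = (\<chi> i. \<theta> $ i / (\<Sum>k\<in>UNIV. \<theta> $ k))"

lemma sum_theta_pos: "0 < (\<Sum>k\<in>UNIV. \<theta> $ k)"
  using theta_pos by (intro sum_pos) auto

lemma invariant_probability_vector_iff: "invariant_probability_vector q v \<longleftrightarrow> v = invariant"
proof -
  let ?S = "\<Sum>k\<in>UNIV. \<theta> $ k"
  have comp: "(v v* q) $ j = \<theta> $ j * (\<Sum>i\<in>UNIV. v $ i) - ?S * v $ j" for v :: "real^'d" and j
  proof -
    have "(v v* q) $ j = (\<Sum>i\<in>UNIV. \<theta> $ j * v $ i - (if i = j then ?S * v $ j else 0))"
      by (auto simp: vector_matrix_mult_def q_eq algebra_simps intro!: sum.cong)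
    then show ?thesis by (simp add: sum_subtractf sum_distrib_left)
  qed
  have S: "?S \<noteq> 0" using sum_theta_pos by simp
  have inv1: "(\<Sum>i\<in>UNIV. invariant $ i) = 1"
    using S by (simp add: invariant_def sum_divide_distrib[symmetric])
  show ?thesis
  proof
    assume v: "invariant_probability_vector q v"
    then have "(\<Sum>i\<in>UNIV. v $ i) = 1" "v v* q = 0"
      by (auto simp: invariant_probability_vector_def probability_vector_def)
    then have zero: "\<theta> $ j - ?S * v $ j = 0" for j using comp[of v j] by simp
    have "v $ j = invariant $ j" for j using zero[of j] S by (simp add: invariant_def field_simps)
    then show "v = invariant" by (simp add: vec_eq_iff)
  next
    assume v: "v = invariant"
    have "?S * invariant $ j = \<theta> $ j" for j using S by (simp add: invariant_def)
    then have "(v v* q) $ j = 0" for j using comp[of invariant j] inv1 v by simp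
    then have "v v* q = 0" by (simp add: vec_eq_iff)
    moreover have "0 \<le> invariant $ i" for i
      using less_imp_le[OF theta_pos] less_imp_le[OF sum_theta_pos]
      by (simp add: invariant_def)
    ultimately show "invariant_probability_vector q v"
      using inv1 v by (simp add: invariant_probability_vector_def probability_vector_def)
  qed
qed

lemma parameter_pos: "0 < (a *\<^sub>R \<theta>) $ k"
  using theta_pos a_pos by simp

lemma size_biased_parameter_pos: "0 < (a *\<^sub>R \<theta> + axis i 1) $ k"
  using theta_pos[of k] a_pos by (auto simp: axis_def intro!: add_pos_pos)

lemma dirichlet_moment_total:
  "(\<integral>x. monomial m x \<partial>dirichlet (a *\<^sub>R \<theta>)) =
    weight_product m / pochhammer total_weight (\<Sum>k\<in>UNIV. m k)"
  by (simp add: dirichlet_moment[OF parameter_pos] weight_product_def sum_distrib_left)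

text \<open>
  Adding \<open>e\<^sub>i\<close> to the parameter shifts one rising factorial in the numerator and the one in the
  denominator, and \<open>\<nu>\<^sub>i = a \<theta>\<^sub>i / (a |\<theta>|)\<close> supplies the two missing first factors.
\<close>

lemma dirichlet_moment_size_biased:
  "invariant $ i * (\<integral>x. monomial m x \<partial>dirichlet (a *\<^sub>R \<theta> + axis i 1)) =
    weight_product m * (a * \<theta> $ i + real (m i)) / pochhammer total_weight (Suc (\<Sum>k\<in>UNIV. m k))"
proof -
  let ?\<beta> = "a *\<^sub>R \<theta> + axis i 1" and ?d = "\<Sum>k\<in>UNIV. m k"
  have U: "(UNIV :: 'd set) = insert i (UNIV - {i})" by auto
  have sum: "(\<Sum>k\<in>UNIV. ?\<beta> $ k) = total_weight + 1"
    by (simp add: sum.distrib sum_distrib_left axis_def)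
  have "(a * \<theta> $ i) * (\<Prod>k\<in>UNIV. pochhammer (?\<beta> $ k) (m k)) =
      (a * \<theta> $ i) * (pochhammer (a * \<theta> $ i + 1) (m i) *
        (\<Prod>k\<in>UNIV - {i}. pochhammer (a * \<theta> $ k) (m k)))"
    by (subst U, subst prod.insert) (auto simp: axis_def intro!: prod.cong)
  also have "\<dots> = pochhammer (a * \<theta> $ i) (Suc (m i)) * (\<Prod>k\<in>UNIV - {i}. pochhammer (a * \<theta> $ k) (m k))"
    by (simp add: pochhammer_rec mult.assoc)
  also have "\<dots> = weight_product m * (a * \<theta> $ i + real (m i))"
    unfolding weight_product_def by (subst (2) U, subst prod.insert) (auto simp: pochhammer_Suc)
  finally have num: "(a * \<theta> $ i) * (\<Prod>k\<in>UNIV. pochhammer (?\<beta> $ k) (m k)) =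
      weight_product m * (a * \<theta> $ i + real (m i))" .
  have "invariant $ i = (a * \<theta> $ i) / total_weight"
    using a_pos by (simp add: invariant_def)
  then have "invariant $ i * (\<integral>x. monomial m x \<partial>dirichlet ?\<beta>) =
      ((a * \<theta> $ i) * (\<Prod>k\<in>UNIV. pochhammer (?\<beta> $ k) (m k))) /
      (total_weight * pochhammer (total_weight + 1) ?d)"
    unfolding dirichlet_moment[OF size_biased_parameter_pos] sum by simp
  then show ?thesis unfolding num by (simp add: pochhammer_rec)
qed

lemma state_limit:
  fixes f :: "real^'d \<Rightarrow> real"
  assumes "continuous_on UNIV f"
  shows "(\<lambda>n. expectation (\<lambda>\<omega>. indicator (state_event (Suc n) i) \<omega> * f (empirical_measure I (Suc n) \<omega>)))
    \<longlonglongrightarrow> invariant $ i * (\<integral>x. f x \<partial>dirichlet (a *\<^sub>R \<theta> + axis i 1))"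
proof (rule weighted_moment_method[OF prob_space_axioms _ _ _ _ _ _ _ _ assms])
  show "(\<lambda>n. expectation (\<lambda>\<omega>. indicator (state_event (Suc n) i) \<omega> * monomial m (empirical_measure I (Suc n) \<omega>)))
    \<longlonglongrightarrow> invariant $ i * (\<integral>x. monomial m x \<partial>dirichlet (a *\<^sub>R \<theta> + axis i 1))" for m
    using LIMSEQ_Suc[OF moment_limits[OF refl, of m, THEN conjunct2, rule_format, of i]]
    unfolding dirichlet_moment_size_biased state_moment_def by (simp add: mult.commute)
  show "AE x in dirichlet (a *\<^sub>R \<theta> + axis i 1). x \<in> prob_simplex"
    by (rule AE_dirichlet[OF size_biased_parameter_pos])
  show "prob_space (dirichlet (a *\<^sub>R \<theta> + axis i 1))"
    by (rule prob_space_dirichlet[OF size_biased_parameter_pos])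
  show "(\<lambda>\<omega>. indicator (state_event (Suc n) i) \<omega> :: real) \<in> borel_measurable M" for n
    by (intro borel_measurable_indicator state_event_measurable) simp
qed (simp_all add: empirical_measure_in_prob_simplex)

lemma total_limit:
  fixes f :: "real^'d \<Rightarrow> real"
  assumes "continuous_on UNIV f"
  shows "(\<lambda>n. expectation (\<lambda>\<omega>. f (empirical_measure I (Suc n) \<omega>)))
    \<longlonglongrightarrow> (\<integral>x. f x \<partial>dirichlet (a *\<^sub>R \<theta>))"
proof -
  have "(\<lambda>n. expectation (\<lambda>\<omega>. 1 * f (empirical_measure I (Suc n) \<omega>)))
    \<longlonglongrightarrow> 1 * (\<integral>x. f x \<partial>dirichlet (a *\<^sub>R \<theta>))"
  proof (rule weighted_moment_method[OF prob_space_axioms _ _ _ _ _ _ _ _ assms])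
    show "(\<lambda>n. expectation (\<lambda>\<omega>. 1 * monomial m (empirical_measure I (Suc n) \<omega>)))
      \<longlonglongrightarrow> 1 * (\<integral>x. monomial m x \<partial>dirichlet (a *\<^sub>R \<theta>))" for m
      using LIMSEQ_Suc[OF moment_limits[OF refl, of m, THEN conjunct1]]
      unfolding dirichlet_moment_total by (simp add: sum_state_moment)
    show "AE x in dirichlet (a *\<^sub>R \<theta>). x \<in> prob_simplex"
      by (rule AE_dirichlet[OF parameter_pos])
    show "prob_space (dirichlet (a *\<^sub>R \<theta>))"
      by (rule prob_space_dirichlet[OF parameter_pos])
  qed (simp_all add: empirical_measure_in_prob_simplex)
  then show ?thesis by simp
qed

lemma state_probability_limit: "(\<lambda>n. \<P>(\<omega> in M. I n \<omega> = i)) \<longlonglongrightarrow> invariant $ i"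
proof -
  interpret D: prob_space "dirichlet (a *\<^sub>R \<theta> + axis i 1)"
    by (intro prob_space_dirichlet size_biased_parameter_pos)
  have "expectation (\<lambda>\<omega>. indicator (state_event (Suc n) i) \<omega> * 1) = \<P>(\<omega> in M. I (Suc n) \<omega> = i)" for n
    by (simp add: state_event_def Int_absorb2)
  with state_limit[of "\<lambda>_. 1" i]
  have "(\<lambda>n. \<P>(\<omega> in M. I (Suc n) \<omega> = i)) \<longlonglongrightarrow>
      invariant $ i * (\<integral>x. 1 \<partial>dirichlet (a *\<^sub>R \<theta> + axis i 1))"
    by (simp only: continuous_on_const)
  moreover have "(\<integral>x. 1 \<partial>dirichlet (a *\<^sub>R \<theta> + axis i 1)) = (1 :: real)"
    using D.prob_space by simp
  ultimately have "(\<lambda>n. \<P>(\<omega> in M. I (Suc n) \<omega> = i)) \<longlonglongrightarrow> invariant $ i"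
    by (simp only: mult_1_right)
  then show ?thesis by (rule LIMSEQ_imp_Suc)
qed

text \<open>
  Both integrals split over the finitely many states, which reduces the claim to \<open>state_limit\<close>. The limit
  is taken along successors because nothing is assumed about the chain at time 0.
\<close>

lemma joint_limit:
  fixes f :: "(real^'d) \<times> 'd \<Rightarrow> real"
  assumes cont: "\<And>i. continuous_on UNIV (\<lambda>x. f (x, i))" and B: "\<And>z. \<bar>f z\<bar> \<le> B"
  shows "(\<lambda>n. \<integral>z. f z \<partial>distr M (borel \<Otimes>\<^sub>M count_space UNIV) (\<lambda>\<omega>. (empirical_measure I n \<omega>, I n \<omega>)))
    \<longlonglongrightarrow> (\<integral>z. f z \<partial>finite_mixture (borel \<Otimes>\<^sub>M count_space UNIV) invariant
          (\<lambda>i. dirichlet (a *\<^sub>R \<theta> + axis i 1) \<Otimes>\<^sub>M return (count_space UNIV) i))"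
proof (rule LIMSEQ_imp_Suc)
  have fi: "(\<lambda>x. f (x, i)) \<in> borel_measurable borel" for i
    using cont by (rule borel_measurable_continuous_onI)
  have f: "f \<in> borel_measurable (borel \<Otimes>\<^sub>M count_space UNIV)"
  proof -
    \<comment> \<open>a finite sum over the state makes joint measurability follow from that of the sections\<close>
    define g where "g z = (\<Sum>i\<in>UNIV. indicator {i} (snd z) * f (fst z, i))" for z
    have "g \<in> borel_measurable (borel \<Otimes>\<^sub>M count_space UNIV)"
      unfolding g_def using measurable_compose[OF measurable_fst fi] by measurable
    moreover have "f = g"
    proof
      show "f z = g z" for z by (cases z) (simp add: g_def indicator_def)
    qed
    ultimately show ?thesis by (simp only:)
  qed
  note prob = prob_space_dirichlet[OF size_biased_parameter_pos]
  have "(\<integral>z. f z \<partial>finite_mixture (borel \<Otimes>\<^sub>M count_space UNIV) invariant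
          (\<lambda>i. dirichlet (a *\<^sub>R \<theta> + axis i 1) \<Otimes>\<^sub>M return (count_space UNIV) i)) =
      (\<Sum>i\<in>UNIV. invariant $ i * (\<integral>z. f z \<partial>(dirichlet (a *\<^sub>R \<theta> + axis i 1) \<Otimes>\<^sub>M return (count_space UNIV) i)))"
  proof (rule integral_finite_mixture[OF _ _ _ f B])
    show "sets (dirichlet (a *\<^sub>R \<theta> + axis i 1) \<Otimes>\<^sub>M return (count_space UNIV) i) =
        sets (borel \<Otimes>\<^sub>M count_space UNIV)" for i
      by (intro sets_pair_measure_cong) auto
    show "prob_space (dirichlet (a *\<^sub>R \<theta> + axis i 1) \<Otimes>\<^sub>M return (count_space UNIV) i)" for i
      by (intro prob_space_pair prob prob_space_return) simp
    show "0 \<le> invariant $ i" for i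
      using less_imp_le[OF theta_pos] less_imp_le[OF sum_theta_pos] by (simp add: invariant_def)
  qed
  also have "\<dots> = (\<Sum>i\<in>UNIV. invariant $ i * (\<integral>x. f (x, i) \<partial>dirichlet (a *\<^sub>R \<theta> + axis i 1)))"
    by (simp add: integral_pair_return[OF prob sets_dirichlet f])
  finally have mixture: "(\<integral>z. f z \<partial>finite_mixture (borel \<Otimes>\<^sub>M count_space UNIV) invariant
          (\<lambda>i. dirichlet (a *\<^sub>R \<theta> + axis i 1) \<Otimes>\<^sub>M return (count_space UNIV) i)) =
      (\<Sum>i\<in>UNIV. invariant $ i * (\<integral>x. f (x, i) \<partial>dirichlet (a *\<^sub>R \<theta> + axis i 1)))" .
  have split: "(\<integral>z. f z \<partial>distr M (borel \<Otimes>\<^sub>M count_space UNIV) (\<lambda>\<omega>. (empirical_measure I (Suc n) \<omega>, I (Suc n) \<omega>))) =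
      (\<Sum>i\<in>UNIV. expectation (\<lambda>\<omega>. indicator (state_event (Suc n) i) \<omega> * f (empirical_measure I (Suc n) \<omega>, i)))" for n
  proof -
    have pair: "(\<lambda>\<omega>. (empirical_measure I (Suc n) \<omega>, I (Suc n) \<omega>)) \<in> measurable M (borel \<Otimes>\<^sub>M count_space UNIV)"
      by (intro measurable_Pair empirical_measure_measurable measurable_state) simp
    have "integrable M (\<lambda>\<omega>. indicator (state_event (Suc n) i) \<omega> * f (empirical_measure I (Suc n) \<omega>, i))" for i
    proof (rule integrable_const_bound[where B = B])
      show "AE \<omega> in M. norm (indicator (state_event (Suc n) i) \<omega> * f (empirical_measure I (Suc n) \<omega>, i)) \<le> B"
        using B order_trans[OF abs_ge_zero B] by (intro AE_I2) (simp add: indicator_def)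
      show "(\<lambda>\<omega>. indicator (state_event (Suc n) i) \<omega> * f (empirical_measure I (Suc n) \<omega>, i)) \<in> borel_measurable M"
        by (intro borel_measurable_times borel_measurable_indicator state_event_measurable
            measurable_compose[OF empirical_measure_measurable fi]) simp
    qed
    then have "(\<Sum>i\<in>UNIV. expectation (\<lambda>\<omega>. indicator (state_event (Suc n) i) \<omega> * f (empirical_measure I (Suc n) \<omega>, i))) =
        expectation (\<lambda>\<omega>. \<Sum>i\<in>UNIV. indicator (state_event (Suc n) i) \<omega> * f (empirical_measure I (Suc n) \<omega>, i))"
      by (intro Bochner_Integration.integral_sum[symmetric])
    also have "\<dots> = expectation (\<lambda>\<omega>. f (empirical_measure I (Suc n) \<omega>, I (Suc n) \<omega>))"
      by (intro Bochner_Integration.integral_cong) (auto simp: state_event_def indicator_def)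
    finally show ?thesis by (simp add: integral_distr[OF pair f])
  qed
  show "(\<lambda>n. \<integral>z. f z \<partial>distr M (borel \<Otimes>\<^sub>M count_space UNIV) (\<lambda>\<omega>. (empirical_measure I (Suc n) \<omega>, I (Suc n) \<omega>)))
    \<longlonglongrightarrow> (\<integral>z. f z \<partial>finite_mixture (borel \<Otimes>\<^sub>M count_space UNIV) invariant
          (\<lambda>i. dirichlet (a *\<^sub>R \<theta> + axis i 1) \<Otimes>\<^sub>M return (count_space UNIV) i))"
    unfolding mixture split by (intro tendsto_sum state_limit cont)
qed

end

section \<open>Convergence in distribution\<close>

theorem proposition4p1:
  fixes M :: "'a measure"
    and p :: "nat \<Rightarrow> real"
    and q :: "real^'d^'d"
    and r :: "nat \<Rightarrow> 'd \<Rightarrow> 'd \<Rightarrow> real"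
    and I :: "nat \<Rightarrow> 'a \<Rightarrow> 'd::finite"
    and \<theta> :: "real^'d"
    and a :: real
  assumes theta_pos: "\<And>j. 0 < \<theta> $ j"
    and q_eq: "\<And>i j. q $ i $ j = \<theta> $ j - (if i = j then (\<Sum>k\<in>UNIV. \<theta> $ k) else 0)"
    and chain: "freezing_markov_chain M p q r I"
    and a_pos: "0 < a"
    and p_asymp: "p \<sim>[sequentially] (\<lambda>n. a / real n)"
  shows "\<exists>\<nu> :: real^'d.
      (\<forall>v. invariant_probability_vector q v \<longleftrightarrow> v = \<nu>) \<and>
      (\<forall>i. \<nu> $ i = \<theta> $ i / (\<Sum>k\<in>UNIV. \<theta> $ k)) \<and>
      weakly_converges (prod_topology euclidean (discrete_topology UNIV))
        (\<lambda>n. distr M (borel \<Otimes>\<^sub>M count_space UNIV) (\<lambda>\<omega>. (empirical_measure I n \<omega>, I n \<omega>)))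
        (finite_mixture (borel \<Otimes>\<^sub>M count_space UNIV) \<nu>
          (\<lambda>i. dirichlet (a *\<^sub>R \<theta> + axis i 1) \<Otimes>\<^sub>M return (count_space UNIV) i)) \<and>
      weakly_converges euclidean
        (\<lambda>n. distr M borel (empirical_measure I n)) (dirichlet (a *\<^sub>R \<theta>)) \<and>
      (\<forall>i. (\<lambda>n. \<P>(\<omega> in M. I n \<omega> = i)) \<longlonglongrightarrow> \<nu> $ i)"
proof -
  interpret freezing_markov_chain M p q r I by (rule chain)
  have p_rate: "(\<lambda>n. real n * p n) \<longlonglongrightarrow> a"
  proof -
    have "(\<lambda>n. p n / (a / real n)) \<longlonglongrightarrow> 1"
      using a_pos by (intro asymp_equivD_strong[OF p_asymp])
        (auto intro!: eventually_mono[OF eventually_gt_at_top[of "0 :: nat"]])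
    from tendsto_mult_left[OF this, of a] show ?thesis using a_pos by (simp add: mult.commute)
  qed
  interpret mutation_freezing_chain M p q r I \<theta> a
    by unfold_locales (fact theta_pos q_eq a_pos p_rate)+
  have joint: "weakly_converges (prod_topology euclidean (discrete_topology UNIV))
        (\<lambda>n. distr M (borel \<Otimes>\<^sub>M count_space UNIV) (\<lambda>\<omega>. (empirical_measure I n \<omega>, I n \<omega>)))
        (finite_mixture (borel \<Otimes>\<^sub>M count_space UNIV) invariant
          (\<lambda>i. dirichlet (a *\<^sub>R \<theta> + axis i 1) \<Otimes>\<^sub>M return (count_space UNIV) i))"
    unfolding weakly_converges_def
  proof (intro allI impI, elim conjE)
    fix f :: "(real^'d) \<times> 'd \<Rightarrow> real"
    assume f: "continuous_map (prod_topology euclidean (discrete_topology UNIV)) euclideanreal f"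
      and bdd: "bounded (f ` topspace (prod_topology euclidean (discrete_topology UNIV)))"
    have "continuous_on UNIV (\<lambda>x. f (x, i))" for i
    proof -
      have "continuous_map euclidean (prod_topology euclidean (discrete_topology UNIV)) (\<lambda>x :: real^'d. (x, i))"
        by (simp add: continuous_map_paired)
      from continuous_map_compose[OF this f] show ?thesis by (simp add: o_def)
    qed
    moreover obtain B where "\<And>z. \<bar>f z\<bar> \<le> B" using bdd by (auto simp: bounded_iff)
    ultimately show "(\<lambda>n. \<integral>z. f z \<partial>distr M (borel \<Otimes>\<^sub>M count_space UNIV)
        (\<lambda>\<omega>. (empirical_measure I n \<omega>, I n \<omega>))) \<longlonglongrightarrow>
      (\<integral>z. f z \<partial>finite_mixture (borel \<Otimes>\<^sub>M count_space UNIV) invariant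
          (\<lambda>i. dirichlet (a *\<^sub>R \<theta> + axis i 1) \<Otimes>\<^sub>M return (count_space UNIV) i))"
      by (rule joint_limit)
  qed
  have marginal: "weakly_converges euclidean
      (\<lambda>n. distr M borel (empirical_measure I n)) (dirichlet (a *\<^sub>R \<theta>))"
    unfolding weakly_converges_def
  proof (intro allI impI, elim conjE)
    fix f :: "real^'d \<Rightarrow> real"
    assume "continuous_map euclidean euclideanreal f"
    then have f: "continuous_on UNIV f" by simp
    have eq: "(\<integral>x. f x \<partial>distr M borel (empirical_measure I n)) =
        expectation (\<lambda>\<omega>. f (empirical_measure I n \<omega>))" for n
      by (intro integral_distr empirical_measure_measurable borel_measurable_continuous_onI f)
    show "(\<lambda>n. \<integral>x. f x \<partial>distr M borel (empirical_measure I n)) \<longlonglongrightarrow>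
        (\<integral>x. f x \<partial>dirichlet (a *\<^sub>R \<theta>))"
      unfolding eq using total_limit[OF f] by (rule LIMSEQ_imp_Suc)
  qed
  show ?thesis
    using invariant_probability_vector_iff joint marginal state_probability_limit
    by (intro exI[of _ invariant]) (auto simp: invariant_def)
qed

end
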